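(* Let $a>0$ and let $k$ be a positive integer. Define \[J_{2k}(a)=\int_0^\infty\frac{x\,e^{-\pi a x^2}}{e^{2\pi x}-1}\,{}_1F_1\!\left(-2k;\tfrac{3}{2};2\pi a x^2\right)dx .\] Then \[J_{2k}(a)=T_{2k}(a)+\epsilon_{2k}(a),\] where \[T_{2k}(a)=\frac{1}{4\pi a}\left\{\left(\frac{1+a^{1/2}}{2}\right)\sqrt{\frac{\pi}{2}}\,\frac{\Gamma(2k+1)}{\Gamma(2k+\frac{3}{2})}-{}_2F_1\!\left(-2k,1;\tfrac{3}{2};2\right)\right\}\] and \[\epsilon_{2k}(a)=\frac{1}{4\pi a}\int_1^\infty \{\psi(t)+a^{1/2}\phi(t)\}\,\frac{(t-1)^{2k}}{(1+t)^{2k+3/2}}\,dt,\] with $\psi(t)=\sum_{n\ge1}e^{-\pi n^2 t/a}$ and $\phi(t)=\sum_{n\ge1}e^{-\pi n^2 a t}$.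
   Context: ${}_1F_1$ denotes Kummer's confluent hypergeometric function and ${}_2F_1$ the Gauss hypergeometric function; for the negative integer parameter $-2k$ both series terminate. *)

theory Defs
  imports "HOL-Analysis.Analysis"
begin

definition hyp1F1 :: "real \<Rightarrow> real \<Rightarrow> real \<Rightarrow> real" where
  "hyp1F1 a b z = (\<Sum>n. pochhammer a n / pochhammer b n * z ^ n / fact n)"

definition hyp2F1 :: "real \<Rightarrow> real \<Rightarrow> real \<Rightarrow> real \<Rightarrow> real" where
  "hyp2F1 a b c z = (\<Sum>n. pochhammer a n * pochhammer b n / pochhammer c n * z ^ n / fact n)"

definition psi_theta :: "real \<Rightarrow> real \<Rightarrow> real" where
  "psi_theta a t = (\<Sum>n. exp (- pi * (real (Suc n))^2 * t / a))"

definition phi_theta :: "real \<Rightarrow> real \<Rightarrow> real" where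
  "phi_theta a t = (\<Sum>n. exp (- pi * (real (Suc n))^2 * a * t))"

definition J :: "nat \<Rightarrow> real \<Rightarrow> real" where
  "J k a = (LBINT x:{0<..}. x * exp (- pi * a * x^2) / (exp (2 * pi * x) - 1)
              * hyp1F1 (- real (2*k)) (3/2) (2 * pi * a * x^2))"

definition T :: "nat \<Rightarrow> real \<Rightarrow> real" where
  "T k a = 1 / (4 * pi * a) *
     ((1 + sqrt a) / 2 * sqrt (pi / 2) * Gamma (real (2*k) + 1) / Gamma (real (2*k) + 3/2)
      - hyp2F1 (- real (2*k)) 1 (3/2) 2)"

definition eps :: "nat \<Rightarrow> real \<Rightarrow> real" where
  "eps k a = 1 / (4 * pi * a) *
     (LBINT t:{1<..}. (psi_theta a t + sqrt a * phi_theta a t)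
        * (t - 1) ^ (2*k) / (1 + t) powr (real (2*k) + 3/2))"

end

theory Submission
  imports Defs "HOL-Probability.Characteristic_Functions"
begin

text \<open>
  Put \<open>n = 2 * k\<close>, let \<open>E x\<close> be the Gaussian times the Kummer polynomial occurring in \<open>J k a\<close>, and let
  \<open>K t = (t - 1) ^ n / (1 + t) powr (n + 3/2)\<close>. Up to a constant \<open>K\<close> is the Laplace transform
  \<open>\<integral> x\<^sup>2 * E x * exp (- pi * a * x\<^sup>2 * t) dx\<close>. Integrating \<open>phi_theta a * K\<close> over the positive
  half-line termwise therefore gives the integral of \<open>x\<^sup>2 * E x * (\<Sum>N\<ge>1. 1 / (x\<^sup>2 + N\<^sup>2))\<close>, and the
  partial fractions of coth turn this into \<open>J k a\<close> plus elementary integrals. On the other hand,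
  \<open>K (1/t) = t powr (3/2) * K t\<close> for even \<open>n\<close>, so the theta transformation maps the part of the
  integral over the unit interval to an integral of \<open>psi_theta a * K\<close> over \<open>t > 1\<close>; what
  remains is \<open>eps k a\<close> together with Beta integrals of \<open>K\<close>. Both the partial fractions of coth and the
  theta transformation are instances of Poisson summation.
\<close>

subsection \<open>Cosine series and Poisson summation\<close>

text \<open>
  Since \<open>D\<close> is symmetric about \<open>1/2\<close>, it is a continuous function of \<open>cos (2 * pi * x)\<close>, so
  Weierstrass approximation reduces the claim to powers of this cosine.
\<close>

lemma cos_coefficients_zero_imp_zero:
  fixes D :: "real \<Rightarrow> real"
  assumes cont: "continuous_on {0..1} D"
    and sym: "\<And>x. x \<in> {0..1} \<Longrightarrow> D (1 - x) = D x"
    and zero: "\<And>k::nat. ((\<lambda>x. D x * cos (2 * pi * real k * x)) has_integral 0) {0..1}"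
    and x: "x \<in> {0..1}"
  shows "D x = 0"
proof -
  \<comment> \<open>The index \<open>k\<close> stays general in the induction on \<open>m\<close>:
    the product-to-sum formula trades one factor \<open>cos (2 * pi * x)\<close> for shifts of
    \<open>k\<close> by one in both directions.\<close>
  have powers: "((\<lambda>x. D x * cos (2 * pi * real k * x) * cos (2 * pi * x) ^ m) has_integral 0) {0..1}"
    for k m :: nat
  proof (induction m arbitrary: k)
    case 0
    then show ?case using zero by simp
  next
    case (Suc m)
    show ?case
    proof (cases k)
      \<comment> \<open>Here the lower shift would be negative, but the factor indexed by
        \<open>k\<close> is 1, so the additional cosine itself takes its place with index 1.\<close>
      case 0
      then show ?thesis using Suc.IH[of 1] by (simp add: mult_ac)
    next
      case (Suc j)
      have prod: "2 * (cos (2 * pi * real k * x) * cos (2 * pi * x)) =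
          cos (2 * pi * real j * x) + cos (2 * pi * real (Suc k) * x)" for x
        using cos_times_cos[of "2 * pi * real k * x" "2 * pi * x"] Suc
        by (simp add: algebra_simps)
      have eq: "D x * cos (2 * pi * real k * x) * cos (2 * pi * x) ^ Suc m =
          (D x * cos (2 * pi * real j * x) * cos (2 * pi * x) ^ m +
           D x * cos (2 * pi * real (Suc k) * x) * cos (2 * pi * x) ^ m) / 2" for x
      proof -
        have "D x * cos (2 * pi * real k * x) * cos (2 * pi * x) ^ Suc m =
            D x * (2 * (cos (2 * pi * real k * x) * cos (2 * pi * x))) * cos (2 * pi * x) ^ m / 2"
          by simp
        also have "\<dots> = D x * (cos (2 * pi * real j * x) + cos (2 * pi * real (Suc k) * x)) * cos (2 * pi * x) ^ m / 2"
          unfolding prod ..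
        finally show ?thesis by (simp only: distrib_left distrib_right)
      qed
      show ?thesis
        unfolding eq using has_integral_divide[OF has_integral_add[OF Suc.IH[of j] Suc.IH[of "Suc k"]], of 2]
        by simp
    qed
  qed
  \<comment> \<open>\<open>arccos\<close> only reaches the left half of the unit interval; the
    symmetry of \<open>D\<close> recovers the right half.\<close>
  define E where "E y = D (arccos y / (2 * pi))" for y
  have contE: "continuous_on {-1..1} E"
    unfolding E_def
    by (intro continuous_on_compose2[OF cont] continuous_intros)
       (auto simp: arccos_lbound intro!: arccos_ubound[THEN order_trans])
  have E: "E (cos (2 * pi * x)) = D x" if "x \<in> {0..1}" for x
  proof (cases "x \<le> 1/2")
    case True
    then show ?thesis using that pi_gt_zero by (simp add: E_def arccos_cos field_simps)
  next
    case False
    have "cos (2 * pi * x) = cos (2 * pi * (1 - x))"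
      using cos_diff[of "2 * pi" "2 * pi * x"] by (simp add: right_diff_distrib)
    moreover have "arccos (cos (2 * pi * (1 - x))) = 2 * pi * (1 - x)"
      using False that by (intro arccos_cos) auto
    ultimately show ?thesis using sym[OF that] by (simp add: E_def)
  qed
  have contD2: "continuous_on {0..1} (\<lambda>x. D x ^ 2)" by (intro continuous_intros cont)
  have contA: "continuous_on {0..1} (\<lambda>x. \<bar>D x\<bar>)" by (intro continuous_intros cont)
  define A where "A = integral {0..1} (\<lambda>x. \<bar>D x\<bar>)"
  define B where "B = integral {0..1} (\<lambda>x. D x ^ 2)"
  have intA: "((\<lambda>x. \<bar>D x\<bar>) has_integral A) {0..1}"
    unfolding A_def by (intro integrable_integral integrable_continuous_real contA)
  have intB: "((\<lambda>x. D x ^ 2) has_integral B) {0..1}"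
    unfolding B_def by (intro integrable_integral integrable_continuous_real contD2)
  \<comment> \<open>Choose a polynomial \<open>p\<close> with \<open>p (cos (2 * pi * x))\<close>
    within \<open>e\<close> of \<open>D x\<close>. By \<open>powers\<close>, \<open>D\<close> is
    orthogonal to it, so subtracting it from one factor of \<open>D x ^ 2\<close> leaves the
    integral \<open>B\<close> unchanged while the integrand becomes at most
    \<open>e * \<bar>D x\<bar>\<close>.\<close>
  have BA: "B \<le> e * A" if "e > 0" for e
  proof -
    obtain p where p: "real_polynomial_function p" "\<And>y. y \<in> {-1..1} \<Longrightarrow> \<bar>E y - p y\<bar> < e"
      using Stone_Weierstrass_real_polynomial_function[OF _ contE \<open>e > 0\<close>] by auto
    obtain a n where pa: "p = (\<lambda>y. \<Sum>i\<le>n. a i * y ^ i)"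
      using p(1) real_polynomial_function_iff_sum by blast
    have "((\<lambda>x. \<Sum>i\<le>n. a i * (D x * cos (2 * pi * real 0 * x) * cos (2 * pi * x) ^ i))
        has_integral (\<Sum>i\<le>n. a i * 0)) {0..1}"
      by (intro has_integral_sum has_integral_mult_right powers) auto
    then have "((\<lambda>x. D x * p (cos (2 * pi * x))) has_integral 0) {0..1}"
      by (simp add: pa sum_distrib_left mult_ac)
    from has_integral_diff[OF intB this]
    have "((\<lambda>x. D x ^ 2 - D x * p (cos (2 * pi * x))) has_integral B) {0..1}" by simp
    then show ?thesis
    proof (rule has_integral_le[OF _ has_integral_mult_right[OF intA]])
      fix x :: real assume x: "x \<in> {0..1}"
      have "D x ^ 2 - D x * p (cos (2 * pi * x)) = D x * (E (cos (2 * pi * x)) - p (cos (2 * pi * x)))"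
        using E[OF x] by (simp add: power2_eq_square algebra_simps)
      also have "\<dots> \<le> \<bar>D x\<bar> * \<bar>E (cos (2 * pi * x)) - p (cos (2 * pi * x))\<bar>"
        by (metis abs_ge_self abs_mult)
      also have "\<dots> \<le> \<bar>D x\<bar> * e"
        using p(2)[of "cos (2 * pi * x)"] by (intro mult_left_mono) auto
      finally show "D x ^ 2 - D x * p (cos (2 * pi * x)) \<le> e * \<bar>D x\<bar>" by (simp add: mult_ac)
    qed
  qed
  have "A \<ge> 0" using has_integral_nonneg[OF intA] by simp
  have "B \<le> 0"
  proof (rule field_le_epsilon)
    fix e :: real assume "e > 0"
    \<comment> \<open>The denominator \<open>A + 1\<close> avoids dividing by a possibly vanishing
      \<open>A\<close>.\<close>
    then have "B \<le> e / (A + 1) * A" using \<open>A \<ge> 0\<close> by (intro BA divide_pos_pos) auto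
    also have "\<dots> = e * (A / (A + 1))" by simp
    also have "\<dots> \<le> e * 1" using \<open>e > 0\<close> \<open>A \<ge> 0\<close> by (intro mult_left_mono) auto
    finally show "B \<le> 0 + e" by simp
  qed
  moreover have "B \<ge> 0" using has_integral_nonneg[OF intB] by simp
  ultimately have "((\<lambda>x. D x ^ 2) has_integral 0) {0..1}" using intB by simp
  then have "D x ^ 2 = 0"
    using has_integral_0_cbox_imp_0[of 0 1 "\<lambda>x. D x ^ 2" x] contD2 x by simp
  then show ?thesis by simp
qed

lemma has_integral_cos_cos:
  fixes j k :: nat
  shows "((\<lambda>x. cos (2 * pi * real k * x) * cos (2 * pi * real j * x)) has_integral
           (if k = j then if j = 0 then 1 else 1/2 else 0)) {0..1}"
proof -
  have cosm: "((\<lambda>x. cos (2 * pi * of_int m * x)) has_integral (if m = 0 then 1 else 0)) {0..1}" for m :: int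
  proof (cases "m = 0")
    case True
    then show ?thesis using has_integral_const_real[of "1::real" 0 1] by simp
  next
    case False
    have "((\<lambda>x. cos (2 * pi * of_int m * x)) has_integral
       (sin (2 * pi * of_int m * 1) / (2 * pi * of_int m) - sin (2 * pi * of_int m * 0) / (2 * pi * of_int m))) {0..1}"
      by (rule fundamental_theorem_of_calculus)
         (auto intro!: derivative_eq_intros simp: False has_real_derivative_iff_has_vector_derivative[symmetric])
    moreover have "sin (2 * pi * of_int m) = 0"
      using sin_integer_2pi[of "of_int m"] by simp
    ultimately show ?thesis using False by simp
  qed
  have eq: "cos (2 * pi * real k * x) * cos (2 * pi * real j * x) =
      (cos (2 * pi * of_int (int k - int j) * x) + cos (2 * pi * of_int (int k + int j) * x)) / 2" for x
    by (subst cos_times_cos) (simp add: algebra_simps)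
  show ?thesis
    unfolding eq
    by (rule has_integral_eq_rhs[OF has_integral_divide[OF has_integral_add[OF cosm cosm]]]) auto
qed

lemma has_integral_suminf:
  fixes f :: "nat \<Rightarrow> real \<Rightarrow> real"
  assumes "\<And>n. continuous_on {a..b} (f n)"
    and "\<And>n x. x \<in> {a..b} \<Longrightarrow> \<bar>f n x\<bar> \<le> M n" and "summable M"
    and I: "\<And>n. (f n has_integral I n) {a..b}"
  shows "((\<lambda>x. \<Sum>n. f n x) has_integral (\<Sum>n. I n)) {a..b}"
proof -
  have u: "uniform_limit {a..b} (\<lambda>n x. \<Sum>i<n. f i x) (\<lambda>x. \<Sum>i. f i x) sequentially"
    by (rule Weierstrass_m_test) (use assms in auto)
  obtain I' L where IJ: "\<And>n. ((\<lambda>x. \<Sum>i<n. f i x) has_integral I' n) {a..b}"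
      "((\<lambda>x. \<Sum>n. f n x) has_integral L) {a..b}" "I' \<longlonglongrightarrow> L"
    by (rule uniform_limit_integral[OF u]) (use assms in \<open>auto intro!: continuous_intros\<close>)
  have "I' = (\<lambda>n. \<Sum>i<n. I i)"
    by (intro ext has_integral_unique[OF IJ(1)] has_integral_sum I) auto
  then have "I sums L" using IJ(3) by (simp add: sums_def)
  then show "((\<lambda>x. \<Sum>n. f n x) has_integral (\<Sum>n. I n)) {a..b}"
    using IJ(2) by (auto simp: sums_iff)
qed

text \<open>Absolute summability makes the candidate series converge uniformly, so its sum is
  continuous and can be integrated termwise against each cosine. It then has the same cosine
  coefficients as \<open>f\<close>, and uniqueness of these coefficients identifies the two
  functions.\<close>

lemma cosine_series:
  fixes f :: "real \<Rightarrow> real"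
  assumes cont: "continuous_on {0..1} f"
    and sym: "\<And>x. x \<in> {0..1} \<Longrightarrow> f (1 - x) = f x"
    and c: "\<And>k::nat. ((\<lambda>x. f x * cos (2 * pi * real k * x)) has_integral c k) {0..1}"
    and summ: "summable (\<lambda>k. \<bar>c k\<bar>)"
    and x: "x \<in> {0..1}"
  shows "(\<lambda>k. (if k = 0 then 1 else 2) * c k * cos (2 * pi * real k * x)) sums f x"
proof -
  \<comment> \<open>All coefficients but the zeroth are doubled because the squared cosines have
    integral 1/2, and the constant has integral 1.\<close>
  define b where "b k = (if k = 0 then 1 else 2) * c k" for k
  have bM: "\<bar>b k * cos y\<bar> \<le> 2 * \<bar>c k\<bar>" for k y
    using mult_mono[of "\<bar>b k\<bar>" "2 * \<bar>c k\<bar>" "\<bar>cos y\<bar>" 1] by (auto simp: b_def abs_mult)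
  have sM: "summable (\<lambda>k. 2 * \<bar>c k\<bar>)" using summ by (rule summable_mult)
  define H where "H x = (\<Sum>k. b k * cos (2 * pi * real k * x))" for x
  have "uniform_limit {0..1} (\<lambda>n x. \<Sum>k<n. b k * cos (2 * pi * real k * x)) H sequentially"
    unfolding H_def by (rule Weierstrass_m_test[OF _ sM]) (use bM in auto)
  then have contH: "continuous_on {0..1} H"
    by (rule uniform_limit_theorem[rotated]) (auto intro!: always_eventually continuous_intros)
  have cos1: "cos (2 * pi * real k * (1 - x)) = cos (2 * pi * real k * x)" for k x
  proof -
    have "cos (2 * pi * real k * (1 - x)) = cos (2 * pi * real k - 2 * pi * real k * x)"
      by (simp add: right_diff_distrib)
    also have "\<dots> = cos (2 * pi * real k * x)"
      using cos_integer_2pi[of "real k"] sin_integer_2pi[of "real k"] by (simp add: cos_diff)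
    finally show ?thesis .
  qed
  have Hj: "((\<lambda>x. H x * cos (2 * pi * real j * x)) has_integral c j) {0..1}" for j
  proof -
    define I where "I k = b k * (if k = j then if j = 0 then 1 else 1/2 else 0)" for k
    have le: "\<bar>b k * (cos (2 * pi * real k * x) * cos (2 * pi * real j * x))\<bar> \<le> 2 * \<bar>c k\<bar>" for k x
    proof -
      have "\<bar>b k * cos (2 * pi * real k * x)\<bar> * \<bar>cos (2 * pi * real j * x)\<bar> \<le> 2 * \<bar>c k\<bar> * 1"
        by (rule mult_mono) (use bM in auto)
      then show ?thesis by (simp add: abs_mult mult_ac)
    qed
    have Iint: "((\<lambda>x. b k * (cos (2 * pi * real k * x) * cos (2 * pi * real j * x))) has_integral I k) {0..1}" for k
      unfolding I_def by (intro has_integral_mult_right has_integral_cos_cos)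
    have "((\<lambda>x. \<Sum>k. b k * (cos (2 * pi * real k * x) * cos (2 * pi * real j * x)))
        has_integral (\<Sum>k. I k)) {0..1}"
      by (rule has_integral_suminf[OF _ le sM Iint]) (intro continuous_intros)
    moreover have "(\<Sum>k. I k) = c j"
    proof -
      have "suminf I = sum I {j}" by (rule suminf_finite) (auto simp: I_def)
      then have "suminf I = I j" by simp
      also have "I j = c j" by (simp add: I_def b_def)
      finally show ?thesis .
    qed
    moreover have "(\<Sum>k. b k * (cos (2 * pi * real k * x) * cos (2 * pi * real j * x))) =
        H x * cos (2 * pi * real j * x)" for x
      unfolding H_def
      by (subst suminf_mult2)
         (simp_all only: mult.assoc real_norm_def bM summable_comparison_test'[OF sM])
    ultimately show ?thesis by simp
  qed
  have "f x - H x = 0"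
  proof (rule cos_coefficients_zero_imp_zero[where D = "\<lambda>x. f x - H x"])
    show "continuous_on {0..1} (\<lambda>x. f x - H x)" by (intro continuous_intros cont contH)
    show "f (1 - x) - H (1 - x) = f x - H x" if "x \<in> {0..1}" for x
      using that sym by (simp add: H_def cos1)
    show "((\<lambda>x. (f x - H x) * cos (2 * pi * real k * x)) has_integral 0) {0..1}" for k
      using has_integral_diff[OF c[of k] Hj[of k]] by (simp add: left_diff_distrib)
  qed (use x in auto)
  moreover have "summable (\<lambda>k. b k * cos (2 * pi * real k * x))"
    by (rule summable_comparison_test'[OF sM]) (simp only: real_norm_def bM)
  then have "(\<lambda>k. b k * cos (2 * pi * real k * x)) sums H x"
    unfolding H_def by (rule summable_sums)
  ultimately show ?thesis by (simp add: b_def)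
qed

text \<open>
  Periodising the even extension of \<open>h\<close> gives \<open>g x + g (1 - x)\<close> on the unit interval, where
  \<open>g x = (\<Sum>n. h (x + n))\<close>.
\<close>

lemma poisson_summation_even:
  fixes h C :: "real \<Rightarrow> real"
  assumes cont: "continuous_on {0..} h"
    and mono: "\<And>x y. 0 \<le> x \<Longrightarrow> x \<le> y \<Longrightarrow> h y \<le> h x"
    and nonneg: "\<And>x. 0 \<le> x \<Longrightarrow> 0 \<le> h x"
    and sh: "summable (\<lambda>n. h (real n))"
    and C: "\<And>k::nat. (\<lambda>N. integral {0..real N} (\<lambda>x. h x * cos (2 * pi * real k * x))) \<longlonglongrightarrow> C (real k)"
    and sC: "summable (\<lambda>k. \<bar>C (real k)\<bar>)"
  shows "h 0 + 2 * (\<Sum>n. h (real (Suc n))) = 2 * C 0 + 4 * (\<Sum>k. C (real (Suc k)))"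
proof -
  define g where "g x = (\<Sum>n. h (x + real n))" for x
  \<comment> \<open>Monotonicity makes the value at the left lattice point a majorant on the whole
    unit interval, which is what the M-test needs.\<close>
  have hM: "\<bar>h (x + real n)\<bar> \<le> h (real n)" if "x \<in> {0..1}" for x n
    using that mono[of "real n" "x + real n"] nonneg[of "x + real n"] by auto
  have conth: "continuous_on {0..1} (\<lambda>x. h (x + real n))" for n
    by (intro continuous_on_compose2[OF cont] continuous_intros) auto
  have "uniform_limit {0..1} (\<lambda>N x. \<Sum>n<N. h (x + real n)) g sequentially"
    unfolding g_def by (rule Weierstrass_m_test[OF _ sh]) (use hM in auto)
  then have contg: "continuous_on {0..1} g"
    by (rule uniform_limit_theorem[rotated]) (auto intro!: always_eventually continuous_intros conth)
  have conthc: "continuous_on {0..b} (\<lambda>x. h x * cos (2 * pi * real k * x))" for b k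
    by (intro continuous_intros continuous_on_subset[OF cont]) auto
  have gint: "((\<lambda>x. g x * cos (2 * pi * real k * x)) has_integral C (real k)) {0..1}" for k :: nat
  proof -
    \<comment> \<open>The half-line cosine integral is cut into unit blocks. Each block moves to the
      unit interval by periodicity of the cosine, and the partial sums of the blocks are the
      truncated integrals whose limit is \<open>C (real k)\<close>.\<close>
    define I where "I n = integral {real n..real (Suc n)} (\<lambda>x. h x * cos (2 * pi * real k * x))" for n
    have per: "cos (2 * pi * real k * (x + real n)) = cos (2 * pi * real k * x)" for x n
    proof -
      have "cos (2 * pi * real k * (x + real n)) = cos (2 * pi * real k * x + 2 * pi * real (k * n))"
        by (simp add: algebra_simps)
      also have "\<dots> = cos (2 * pi * real k * x)"
        using cos_integer_2pi[of "real (k * n)"] sin_integer_2pi[of "real (k * n)"] by (simp only: cos_add) auto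
      finally show ?thesis .
    qed
    have Iint: "((\<lambda>x. h (x + real n) * cos (2 * pi * real k * x)) has_integral I n) {0..1}" for n
    proof -
      have "((\<lambda>x. h x * cos (2 * pi * real k * x)) has_integral I n) {real n..real (Suc n)}"
        unfolding I_def
        by (intro integrable_integral integrable_continuous_real continuous_on_subset[OF conthc[of "real (Suc n)" k]]) auto
      then have "((\<lambda>x. h (x + real n) * cos (2 * pi * real k * (x + real n))) has_integral I n) {real n - real n..real (Suc n) - real n}"
        by (rule has_integral_shift_real_ivl)
      then show ?thesis by (simp add: per)
    qed
    have le: "\<bar>h (x + real n) * cos (2 * pi * real k * x)\<bar> \<le> h (real n)" if "x \<in> {0..1}" for n x
      using mult_mono[OF hM[OF that, of n] abs_cos_le_one[of "2 * pi * real k * x"]] nonneg[of "real n"]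
      by (simp add: abs_mult)
    have "continuous_on {0..1} (\<lambda>x. h (x + real n) * cos (2 * pi * real k * x))" for n
      by (intro continuous_intros conth)
    from has_integral_suminf[OF this le sh Iint]
    have "((\<lambda>x. \<Sum>n. h (x + real n) * cos (2 * pi * real k * x)) has_integral (\<Sum>n. I n)) {0..1}" .
    moreover have "(\<Sum>n<N. I n) = integral {0..real N} (\<lambda>x. h x * cos (2 * pi * real k * x))" for N
    proof (induction N)
      case (Suc N)
      have "integral {0..real N} (\<lambda>x. h x * cos (2 * pi * real k * x)) + I N =
          integral {0..real (Suc N)} (\<lambda>x. h x * cos (2 * pi * real k * x))"
        unfolding I_def
        by (rule Henstock_Kurzweil_Integration.integral_combine) (auto intro!: integrable_continuous_real conthc)
      then show ?case using Suc by simp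
    qed simp
    then have "I sums C (real k)" using C[of k] by (simp add: sums_def)
    then have "(\<Sum>n. I n) = C (real k)" by (simp add: sums_iff)
    moreover have "(\<Sum>n. h (x + real n) * cos (2 * pi * real k * x)) = g x * cos (2 * pi * real k * x)"
      if "x \<in> {0..1}" for x
      unfolding g_def
      by (subst suminf_mult2) (use hM[OF that] in \<open>auto intro!: summable_comparison_test'[OF sh]\<close>)
    ultimately show ?thesis
      using has_integral_eq[of "{0..1}" "\<lambda>x. \<Sum>n. h (x + real n) * cos (2 * pi * real k * x)"] by simp
  qed
  have gint': "((\<lambda>x. g (1 - x) * cos (2 * pi * real k * x)) has_integral C (real k)) {0..1}" for k :: nat
  proof -
    have "(\<lambda>x. 1 - x) ` {0..1::real} = {0..1}" by simp
    then have "((\<lambda>x. g (1 - x) * cos (2 * pi * real k * (1 - x))) has_integral C (real k)) {0..1}"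
      using has_integral_affinity[of "\<lambda>x. g x * cos (2 * pi * real k * x)" "C (real k)" 0 1 "-1" 1] gint[of k]
      by simp
    moreover have "cos (2 * pi * real k * (1 - x)) = cos (2 * pi * real k * x)" for x
      using cos_integer_2pi[of "real k"] sin_integer_2pi[of "real k"] by (simp add: right_diff_distrib cos_diff)
    ultimately show ?thesis by simp
  qed
  \<comment> \<open>Evaluation at 0, where all cosines are 1 and the symmetrised function is
    \<open>g 0 + g 1\<close>. Its coefficients are \<open>2 * C (real k)\<close>, since
    \<open>g x\<close> and \<open>g (1 - x)\<close> contribute equally.\<close>
  have "(\<lambda>k. (if k = 0 then 1 else 2) * (2 * C (real k)) * cos (2 * pi * real k * 0)) sums (g 0 + g (1 - 0))"
  proof (rule cosine_series[where f = "\<lambda>x. g x + g (1 - x)"])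
    show "continuous_on {0..1} (\<lambda>x. g x + g (1 - x))"
      by (intro continuous_intros contg continuous_on_compose2[OF contg]) auto
    show "((\<lambda>x. (g x + g (1 - x)) * cos (2 * pi * real k * x)) has_integral 2 * C (real k)) {0..1}" for k :: nat
      using has_integral_add[OF gint[of k] gint'[of k]] by (simp add: distrib_right)
    show "summable (\<lambda>k. \<bar>2 * C (real k)\<bar>)"
      using summable_mult[OF sC, of 2] by (simp add: abs_mult)
  qed auto
  moreover have "(if k = 0 then 1 else 2) * (2 * C (real k)) * cos (2 * pi * real k * 0) =
      (if k = 0 then 2 else 4) * C (real k)" for k :: nat
    by simp
  ultimately have "(\<lambda>k. (if k = 0 then 2 else 4) * C (real k)) sums (g 0 + g 1)"
    by (simp only: diff_zero)
  from sums_split_initial_segment[OF this, of 1]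
  have "(\<lambda>k. 4 * C (real (Suc k))) sums (g 0 + g 1 - 2 * C 0)" by simp
  moreover have "summable (\<lambda>k. C (real (Suc k)))"
    using sC[THEN summable_rabs_cancel] by (subst summable_Suc_iff)
  then have "(\<lambda>k. 4 * C (real (Suc k))) sums (4 * (\<Sum>k. C (real (Suc k))))"
    by (intro sums_mult summable_sums)
  ultimately have "g 0 + g 1 = 2 * C 0 + 4 * (\<Sum>k. C (real (Suc k)))"
    using sums_unique2 by fastforce
  moreover have "g 0 = h 0 + g 1"
    using suminf_split_head[OF sh] by (simp add: g_def add.commute)
  moreover have "g 1 = (\<Sum>n. h (real (Suc n)))" by (simp add: g_def)
  ultimately show ?thesis by simp
qed

subsection \<open>The partial fractions of coth and the theta transformation\<close>

lemma summable_exp_neg_sq: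
  fixes c :: real
  assumes "c > 0"
  shows "summable (\<lambda>n. exp (- c * (real n)\<^sup>2))"
proof (rule summable_comparison_test')
  show "summable (\<lambda>n. exp (- c) ^ n)" using assms by (intro summable_geometric) auto
  show "norm (exp (- c * (real n)\<^sup>2)) \<le> exp (- c) ^ n" for n
  proof -
    have "real n \<le> (real n)\<^sup>2" by (cases n) (auto simp: power2_eq_square)
    then have "c * real n \<le> c * (real n)\<^sup>2" using assms by simp
    then show ?thesis by (simp add: exp_of_nat_mult[symmetric] mult.commute)
  qed
qed

lemma summable_inverse_Suc_sq: "summable (\<lambda>n. 1 / (real (Suc n))\<^sup>2)"
  using inverse_squares_sums by (simp add: sums_iff add.commute)

lemma summable_inverse_sq_add:
  fixes c :: real
  shows "summable (\<lambda>n. 1 / (c\<^sup>2 + (real (Suc n))\<^sup>2))"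
proof (rule summable_comparison_test'[OF summable_inverse_Suc_sq])
  show "norm (1 / (c\<^sup>2 + (real (Suc n))\<^sup>2)) \<le> 1 / (real (Suc n))\<^sup>2" for n
    by (auto intro!: frac_le add_nonneg_pos)
qed

text \<open>Poisson summation for the exponential \<open>exp (- 2 * pi * c * x)\<close>: the lattice
  sum is geometric and the cosine transform is Lorentzian. Half of coth is written as
  \<open>1 / (exp (2 * pi * c) - 1) + 1/2\<close>, because the first summand is the weight in
  \<open>J\<close>.\<close>

lemma coth_partial_fractions:
  fixes c :: real
  assumes c: "c > 0"
  shows "c * (\<Sum>n. 1 / (c\<^sup>2 + (real (Suc n))\<^sup>2)) = pi * (1 / (exp (2 * pi * c) - 1) + 1/2 - 1 / (2 * pi * c))"
proof -
  define d where "d = 2 * pi * c"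
  have d: "d > 0" using c by (simp add: d_def)
  have "(\<lambda>n. exp (- d) * exp (- d) ^ n) sums (exp (- d) * (1 / (1 - exp (- d))))"
    using d by (intro sums_mult geometric_sums) auto
  then have sE: "(\<lambda>n. exp (- d * real (Suc n))) sums (1 / (exp d - 1))"
  proof -
    have "exp (- d) * (1 / (1 - exp (- d))) = 1 / (exp d - 1)"
      using d by (simp add: exp_minus field_simps)
    moreover have "exp (- d) * exp (- d) ^ n = exp (- d * real (Suc n))" for n
      by (simp add: exp_of_nat_mult[symmetric] exp_add[symmetric] algebra_simps)
    ultimately show ?thesis using \<open>(\<lambda>n. exp (- d) * exp (- d) ^ n) sums _\<close> by simp
  qed
  have "exp (- d * 0) + 2 * (\<Sum>n. exp (- d * real (Suc n))) =
      2 * (c / (2 * pi * (c\<^sup>2 + 0\<^sup>2))) + 4 * (\<Sum>k. c / (2 * pi * (c\<^sup>2 + (real (Suc k))\<^sup>2)))"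
  proof (rule poisson_summation_even[where h = "\<lambda>x. exp (- d * x)" and C = "\<lambda>y. c / (2 * pi * (c\<^sup>2 + y\<^sup>2))"])
    show "continuous_on {0..} (\<lambda>x. exp (- d * x))" by (intro continuous_intros)
    show "summable (\<lambda>n. exp (- d * real n))"
      using sE by (subst summable_Suc_iff[symmetric]) (auto simp: sums_iff)
    show "summable (\<lambda>k. \<bar>c / (2 * pi * (c\<^sup>2 + (real k)\<^sup>2))\<bar>)"
    proof (subst summable_Suc_iff[symmetric])
      have "summable (\<lambda>k. c / (2 * pi) * (1 / (c\<^sup>2 + (real (Suc k))\<^sup>2)))"
        by (intro summable_mult summable_inverse_sq_add)
      then show "summable (\<lambda>k. \<bar>c / (2 * pi * (c\<^sup>2 + (real (Suc k))\<^sup>2))\<bar>)"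
        using c by (simp add: abs_mult)
    qed
    show "(\<lambda>N. integral {0..real N} (\<lambda>x. exp (- d * x) * cos (2 * pi * real k * x)))
        \<longlonglongrightarrow> c / (2 * pi * (c\<^sup>2 + (real k)\<^sup>2))" for k
    proof -
      define w where "w = 2 * pi * real k"
      \<comment> \<open>An antiderivative of \<open>exp (- d * x) * cos (w * x)\<close>, found by
        integrating by parts twice. At integers \<open>w * x\<close> is a multiple of the period, so
        only the geometric factor remains.\<close>
      define F where "F x = exp (- d * x) * (w * sin (w * x) - d * cos (w * x)) / (d\<^sup>2 + w\<^sup>2)" for x
      have pos: "d\<^sup>2 + w\<^sup>2 > 0" using d by (intro add_pos_nonneg) auto
      have F': "(F has_real_derivative exp (- d * x) * cos (w * x)) (at x within S)" for x S
      proof -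
        have "((\<lambda>x. exp (- d * x) * (w * sin (w * x) - d * cos (w * x))) has_real_derivative
            (d\<^sup>2 + w\<^sup>2) * (exp (- d * x) * cos (w * x))) (at x within S)"
          by (rule derivative_eq_intros refl)+ (simp add: algebra_simps power2_eq_square)
        from DERIV_cdivide[OF this, of "d\<^sup>2 + w\<^sup>2"] show ?thesis
          using d unfolding F_def by simp
      qed
      have "integral {0..real N} (\<lambda>x. exp (- d * x) * cos (w * x)) = (d - d * exp (- d) ^ N) / (d\<^sup>2 + w\<^sup>2)" for N
      proof -
        have "((\<lambda>x. exp (- d * x) * cos (w * x)) has_integral (F (real N) - F 0)) {0..real N}"
          by (rule fundamental_theorem_of_calculus)
             (auto intro!: F'[simplified] simp: has_real_derivative_iff_has_vector_derivative[symmetric])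
        moreover have "sin (w * real N) = 0" "cos (w * real N) = 1"
          using cos_integer_2pi[of "real (k * N)"] sin_integer_2pi[of "real (k * N)"] by (auto simp: w_def mult_ac)
        then have "F (real N) - F 0 = (d - d * exp (- d) ^ N) / (d\<^sup>2 + w\<^sup>2)"
          by (simp add: F_def exp_of_nat_mult[symmetric] mult_ac diff_divide_distrib)
        ultimately show ?thesis by (simp add: integral_unique)
      qed
      moreover have "(\<lambda>N. (d - d * exp (- d) ^ N) / (d\<^sup>2 + w\<^sup>2)) \<longlonglongrightarrow> (d - d * 0) / (d\<^sup>2 + w\<^sup>2)"
        using d pos by (intro tendsto_intros LIMSEQ_realpow_zero) auto
      moreover have "(d - d * 0) / (d\<^sup>2 + w\<^sup>2) = c / (2 * pi * (c\<^sup>2 + (real k)\<^sup>2))"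
      proof -
        have "d\<^sup>2 + w\<^sup>2 = (2 * pi) * (2 * pi * (c\<^sup>2 + (real k)\<^sup>2))"
          by (simp add: d_def w_def power2_eq_square algebra_simps)
        then show ?thesis by (simp add: d_def)
      qed
      ultimately show ?thesis by (simp add: w_def)
    qed
  qed (use d in auto)
  moreover have "(\<Sum>k. c / (2 * pi * (c\<^sup>2 + (real (Suc k))\<^sup>2))) = c / (2 * pi) * (\<Sum>n. 1 / (c\<^sup>2 + (real (Suc n))\<^sup>2))"
    by (subst suminf_mult[symmetric]) (auto intro: summable_inverse_sq_add[simplified])
  moreover have "2 * (c / (2 * pi * (c\<^sup>2 + 0\<^sup>2))) = 1 / (pi * c)"
    using c by (simp add: power2_eq_square)
  ultimately have "1 + 2 / (exp d - 1) = 1 / (pi * c) + 2 / pi * (c * (\<Sum>n. 1 / (c\<^sup>2 + (real (Suc n))\<^sup>2)))"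
    using sE by (simp add: sums_iff)
  then have "c * (\<Sum>n. 1 / (c\<^sup>2 + (real (Suc n))\<^sup>2)) = pi / 2 * (1 + 2 / (exp d - 1) - 1 / (pi * c))"
    by simp
  also have "\<dots> = pi * (1 / (exp d - 1) + 1/2 - 1 / (2 * pi * c))"
    by (simp add: algebra_simps)
  finally show ?thesis by (simp add: d_def)
qed

text \<open>This is the real part of the characteristic function of the standard normal
  distribution. The scaling \<open>r = sqrt (2 * pi * s)\<close> is chosen so that half the square
  of \<open>r * x\<close> is \<open>pi * s * x\<^sup>2\<close>; evenness of the integrand halves the
  integral over the whole line.\<close>

lemma gaussian_cosine_integral:
  fixes s y :: real
  assumes s: "s > 0"
  shows "set_integrable lborel {0..} (\<lambda>x. exp (- pi * s * x\<^sup>2) * cos (2 * pi * y * x))"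
    and "(LBINT x:{0..}. exp (- pi * s * x\<^sup>2) * cos (2 * pi * y * x)) = exp (- pi * y\<^sup>2 / s) / (2 * sqrt s)"
proof -
  define r where "r = sqrt (2 * pi * s)"
  have r: "r > 0" using s by (simp add: r_def)
  define f where "f x = exp (- pi * s * x\<^sup>2) * cos (2 * pi * y * x)" for x
  have int: "integrable std_normal_distribution (\<lambda>x. iexp (2 * pi * y / r * x))"
    using real_dist_normal_dist by (intro prob_space.integrable_iexp) (auto simp: real_distribution_def)
  have "Re (char std_normal_distribution (2 * pi * y / r)) = (LINT x|std_normal_distribution. cos (2 * pi * y / r * x))"
    unfolding char_def by (subst integral_Re[OF int, symmetric])
      (simp add: Re_exp Im_divide_of_real)
  also have "\<dots> = (LBINT x. std_normal_density x * cos (2 * pi * y / r * x))"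
    by (subst integral_density) auto
  also have "\<dots> = r * (LBINT x. std_normal_density (r * x) * cos (2 * pi * y / r * (r * x)))"
    using lborel_integral_real_affine[of r "\<lambda>x. std_normal_density x * cos (2 * pi * y / r * x)" 0] r by simp
  also have "(\<lambda>x. std_normal_density (r * x) * cos (2 * pi * y / r * (r * x))) = (\<lambda>x. f x / sqrt (2 * pi))"
    using r s by (auto simp: f_def std_normal_density_def r_def power_mult_distrib fun_eq_iff mult_ac)
  finally have "exp (- (2 * pi * y / r)\<^sup>2 / 2) = r / sqrt (2 * pi) * (LBINT x. f x)"
    by (simp add: char_std_normal_distribution)
  moreover have "- (2 * pi * y / r)\<^sup>2 / 2 = - pi * y\<^sup>2 / s"
    using s by (simp add: r_def power_divide power_mult_distrib) (simp add: power2_eq_square)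
  moreover have "r / sqrt (2 * pi) = sqrt s" by (simp add: r_def real_sqrt_mult)
  ultimately have "exp (- pi * y\<^sup>2 / s) = sqrt s * (LBINT x. f x)" by (simp only:)
  then have whole: "(LBINT x. f x) = exp (- pi * y\<^sup>2 / s) / sqrt s"
    using s by simp
  have "integrable lborel (\<lambda>x. std_normal_density x * cos (2 * pi * y / r * x))"
    by (rule Bochner_Integration.integrable_bound[of _ std_normal_density])
       (auto simp: abs_mult intro!: mult_left_le)
  from lborel_integrable_real_affine[OF this, of r 0]
  have "integrable lborel (\<lambda>x. sqrt (2 * pi) * (std_normal_density (r * x) * cos (2 * pi * y / r * (r * x))))"
    using r by simp
  also have "(\<lambda>x. sqrt (2 * pi) * (std_normal_density (r * x) * cos (2 * pi * y / r * (r * x)))) = f"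
    using r s by (auto simp: f_def std_normal_density_def r_def power_mult_distrib fun_eq_iff mult_ac)
  finally have intf: "integrable lborel f" .
  then show "set_integrable lborel {0..} (\<lambda>x. exp (- pi * s * x\<^sup>2) * cos (2 * pi * y * x))"
    unfolding set_integrable_def f_def[symmetric] by (intro integrable_mult_indicator) auto
  then have "has_bochner_integral lborel (\<lambda>x. indicator {0..} x *\<^sub>R f x) (LBINT x:{0..}. f x)"
    by (simp add: set_integrable_def set_lebesgue_integral_def has_bochner_integral_iff f_def)
  from has_bochner_integral_even_function[OF this]
  have "(LBINT x. f x) = 2 * (LBINT x:{0..}. f x)"
    by (simp add: has_bochner_integral_iff f_def)
  then show "(LBINT x:{0..}. exp (- pi * s * x\<^sup>2) * cos (2 * pi * y * x)) = exp (- pi * y\<^sup>2 / s) / (2 * sqrt s)"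
    using whole by (simp add: f_def)
qed

text \<open>Poisson summation applied to a Gaussian, whose cosine transform is again a Gaussian with
  \<open>s\<close> replaced by its reciprocal.\<close>

lemma theta_transformation:
  fixes s :: real
  assumes s: "s > 0"
  shows "1 + 2 * (\<Sum>n. exp (- pi * s * (real (Suc n))\<^sup>2)) =
         (1 + 2 * (\<Sum>n. exp (- pi * (real (Suc n))\<^sup>2 / s))) / sqrt s"
proof -
  have ss: "summable (\<lambda>n. exp (- pi * (real n)\<^sup>2 / s))"
    using summable_exp_neg_sq[of "pi / s"] s by simp
  have "exp (- pi * s * 0\<^sup>2) + 2 * (\<Sum>n. exp (- pi * s * (real (Suc n))\<^sup>2)) =
      2 * (exp (- pi * 0\<^sup>2 / s) / (2 * sqrt s)) + 4 * (\<Sum>k. exp (- pi * (real (Suc k))\<^sup>2 / s) / (2 * sqrt s))"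
  proof (rule poisson_summation_even[where h = "\<lambda>x. exp (- pi * s * x\<^sup>2)" and C = "\<lambda>y. exp (- pi * y\<^sup>2 / s) / (2 * sqrt s)"])
    show "continuous_on {0..} (\<lambda>x. exp (- pi * s * x\<^sup>2))" by (intro continuous_intros)
    show "exp (- pi * s * y\<^sup>2) \<le> exp (- pi * s * x\<^sup>2)" if "0 \<le> x" "x \<le> y" for x y
      using that s by (auto intro!: mult_left_mono power_mono)
    show "summable (\<lambda>n. exp (- pi * s * (real n)\<^sup>2))"
      using summable_exp_neg_sq[of "pi * s"] s by simp
    show "summable (\<lambda>k. \<bar>exp (- pi * (real k)\<^sup>2 / s) / (2 * sqrt s)\<bar>)"
      using summable_divide[OF ss, of "2 * sqrt s"] s by simp
    show "(\<lambda>N. integral {0..real N} (\<lambda>x. exp (- pi * s * x\<^sup>2) * cos (2 * pi * real k * x)))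
        \<longlonglongrightarrow> exp (- pi * (real k)\<^sup>2 / s) / (2 * sqrt s)" for k
    proof -
      let ?f = "\<lambda>x. exp (- pi * s * x\<^sup>2) * cos (2 * pi * real k * x)"
      \<comment> \<open>Absolute integrability lets the truncations at integers converge to the
        half-line integral; on bounded intervals the Lebesgue and gauge integrals agree.\<close>
      have i: "set_integrable lborel {0..} ?f" by (rule gaussian_cosine_integral(1)[OF s])
      have "(\<lambda>N. LBINT x:{0..real N}. ?f x) \<longlonglongrightarrow> (LBINT x:{0..}. ?f x)"
        by (rule filterlim_compose[OF tendsto_set_lebesgue_integral_at_top[OF _ i] filterlim_real_sequentially]) auto
      moreover have "(LBINT x:{0..real N}. ?f x) = integral {0..real N} ?f" for N
        by (intro set_borel_integral_eq_integral(2) set_integrable_subset[OF i]) auto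
      ultimately show ?thesis by (simp only: gaussian_cosine_integral(2)[OF s])
    qed
  qed auto
  moreover have "(\<Sum>k. exp (- pi * (real (Suc k))\<^sup>2 / s) / (2 * sqrt s)) = (\<Sum>k. exp (- pi * (real (Suc k))\<^sup>2 / s)) / (2 * sqrt s)"
    using ss by (intro suminf_divide) (subst summable_Suc_iff)
  ultimately show ?thesis using s by (simp add: add_divide_distrib)
qed

subsection \<open>The Laplace transform of Gaussian times Kummer polynomial\<close>

lemma set_integral_Ioi_eq_Ici:
  fixes f :: "real \<Rightarrow> real"
  assumes "has_bochner_integral lborel (\<lambda>x. indicator {a..} x *\<^sub>R f x) I"
  shows "set_integrable lborel {a<..} f" "(LBINT x:{a<..}. f x) = I"
proof -
  have "set_integrable lborel {a..} f"
    using assms by (auto simp: set_integrable_def has_bochner_integral_iff)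
  then show i: "set_integrable lborel {a<..} f" by (rule set_integrable_subset) auto
  have "(LBINT x:{a<..}. f x) = (LBINT x:{a..}. f x)"
  proof (unfold set_lebesgue_integral_def, rule integral_cong_AE)
    show "AE x in lborel. indicat_real {a<..} x *\<^sub>R f x = indicat_real {a..} x *\<^sub>R f x"
      using AE_lborel_singleton[of a] by eventually_elim (auto simp: indicator_def)
  qed (use i \<open>set_integrable lborel {a..} f\<close> in \<open>auto simp: set_integrable_def dest: borel_measurable_integrable\<close>)
  then show "(LBINT x:{a<..}. f x) = I"
    using assms by (auto simp: set_lebesgue_integral_def has_bochner_integral_iff)
qed

text \<open>The exponential density, \<open>erlang_density 0 b\<close>, has mass 1; dividing by
  \<open>b\<close> removes its normalisation.\<close>

lemma exp_neg_integral:
  fixes b :: real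
  assumes "b > 0"
  shows "set_integrable lborel {0<..} (\<lambda>t. exp (- b * t))" "(LBINT t:{0<..}. exp (- b * t)) = 1 / b"
proof -
  have "has_bochner_integral lborel (\<lambda>x. erlang_density 0 b x) 1"
    using nn_integral_erlang_ith_moment[OF assms, of 0 0]
    by (intro has_bochner_integral_nn_integral) (use assms in \<open>auto simp: erlang_density_def\<close>)
  then have "has_bochner_integral lborel (\<lambda>x. erlang_density 0 b x / b) (1 / b)"
    by (rule has_bochner_integral_divide)
  also have "(\<lambda>x. erlang_density 0 b x / b) = (\<lambda>x. indicator {0..} x *\<^sub>R exp (- b * x))"
    using assms by (auto simp: erlang_density_def fun_eq_iff indicator_def)
  finally have "has_bochner_integral lborel (\<lambda>x. indicator {0..} x *\<^sub>R exp (- b * x)) (1 / b)" .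
  from set_integral_Ioi_eq_Ici[OF this]
  show "set_integrable lborel {0<..} (\<lambda>t. exp (- b * t))" "(LBINT t:{0<..}. exp (- b * t)) = 1 / b" .
qed

text \<open>Rescaling by \<open>sqrt s\<close> reduces everything to the moments of
  \<open>exp (- x\<^sup>2)\<close>. The even moments are expressed by
  \<open>pochhammer (3/2)\<close> so that they cancel the denominators of the Kummer polynomial; the
  exponent \<open>2 * m + 2\<close> accounts for the factor \<open>x\<^sup>2\<close> of the Laplace
  transform.\<close>

lemma gaussian_moments_pos:
  fixes s :: real
  assumes s: "s > 0"
  shows "set_integrable lborel {0<..} (\<lambda>x. exp (- s * x\<^sup>2) * x ^ p)"
    and "(LBINT x:{0<..}. exp (- s * x\<^sup>2) * x ^ (2 * m + 2)) =
           sqrt pi / 4 * pochhammer (3/2) m / (s ^ m * s * sqrt s)"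
    and "(LBINT x:{0<..}. exp (- s * x\<^sup>2) * x ^ (2 * m + 1)) = fact m / (2 * s ^ (m + 1))"
proof -
  have scale: "has_bochner_integral lborel (\<lambda>x. indicator {0..} x *\<^sub>R (exp (- s * x\<^sup>2) * x ^ p)) (I / sqrt s ^ (p + 1))"
    if "has_bochner_integral lborel (\<lambda>x. indicator {0..} x *\<^sub>R (exp (- x\<^sup>2) * x ^ p)) I" for p I
  proof -
    have "has_bochner_integral lborel (\<lambda>x. indicator {0..} (0 + sqrt s * x) *\<^sub>R (exp (- (0 + sqrt s * x)\<^sup>2) * (0 + sqrt s * x) ^ p) / sqrt s ^ p)
        (I /\<^sub>R \<bar>sqrt s\<bar> / sqrt s ^ p)"
      by (intro has_bochner_integral_divide lborel_has_bochner_integral_real_affine_iff[THEN iffD1, OF _ that])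
         (use s in auto)
    also have "(\<lambda>x. indicator {0..} (0 + sqrt s * x) *\<^sub>R (exp (- (0 + sqrt s * x)\<^sup>2) * (0 + sqrt s * x) ^ p) / sqrt s ^ p) =
        (\<lambda>x. indicator {0..} x *\<^sub>R (exp (- s * x\<^sup>2) * x ^ p))"
      using s by (auto simp: fun_eq_iff power_mult_distrib indicator_def zero_le_mult_iff)
    also have "I /\<^sub>R \<bar>sqrt s\<bar> / sqrt s ^ p = I / sqrt s ^ (p + 1)"
      using s by (simp add: field_simps)
    finally show ?thesis .
  qed
  note even = set_integral_Ioi_eq_Ici[OF scale[OF gaussian_moment_even_pos]]
  note odd = set_integral_Ioi_eq_Ici[OF scale[OF gaussian_moment_odd_pos]]
  show "set_integrable lborel {0<..} (\<lambda>x. exp (- s * x\<^sup>2) * x ^ p)"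
    using even(1)[of "p div 2"] odd(1)[of "p div 2"] by (cases "even p") simp_all
  have f1: "fact (2 * m + 2) / (2 ^ (2 * m + 2) * fact (m + 1)) = pochhammer (3/2) m / (2::real)"
  proof (induction m)
    case (Suc m)
    have "fact (2 * Suc m + 2) / (2 ^ (2 * Suc m + 2) * fact (Suc m + 1)) =
        (real (2 * m + 4) * real (2 * m + 3) / (4 * real (m + 2))) * (fact (2 * m + 2) / (2 ^ (2 * m + 2) * fact (m + 1)) :: real)"
      by (simp add: field_simps)
    also have "real (2 * m + 4) * real (2 * m + 3) / (4 * real (m + 2)) = 3/2 + real m"
      by (simp add: field_simps)
    finally show ?case unfolding Suc by (simp add: pochhammer_Suc)
  qed (simp add: fact_numeral)
  have f2: "sqrt s ^ (2 * m + 2 + 1) = s ^ m * s * sqrt s"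
    using s by (simp add: power_mult)
  have f3: "(LBINT x:{0<..}. exp (- s * x\<^sup>2) * x ^ (2 * m + 2)) =
      sqrt pi / 2 * (fact (2 * m + 2) / (2 ^ (2 * m + 2) * fact (m + 1))) / sqrt s ^ (2 * m + 2 + 1)"
    using even(2)[of "m + 1"] by (simp only: distrib_left mult_1_right)
  show "(LBINT x:{0<..}. exp (- s * x\<^sup>2) * x ^ (2 * m + 2)) =
           sqrt pi / 4 * pochhammer (3/2) m / (s ^ m * s * sqrt s)"
    unfolding f3 f1 f2 by simp
  have "sqrt s ^ (2 * m + 1 + 1) = s ^ (m + 1)"
    using s power_mult[of "sqrt s" 2 "m + 1"] by simp
  then show "(LBINT x:{0<..}. exp (- s * x\<^sup>2) * x ^ (2 * m + 1)) = fact m / (2 * s ^ (m + 1))"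
    using odd(2)[of m] by simp
qed

text \<open>After multiplication by \<open>fact m\<close>, which is \<open>pochhammer 1 m\<close>,
  these are also the coefficients of \<open>hyp2F1 (- real n) 1 (3/2)\<close>.\<close>

definition kummer_coeff :: "nat \<Rightarrow> nat \<Rightarrow> real" where
  "kummer_coeff n m = pochhammer (- real n) m / pochhammer (3/2) m / fact m"

text \<open>The integrand of \<open>J k a\<close> is \<open>x / (exp (2 * pi * x) - 1)\<close> times
  this function at \<open>n = 2 * k\<close>.\<close>

definition kummer_gauss :: "nat \<Rightarrow> real \<Rightarrow> real \<Rightarrow> real" where
  "kummer_gauss n a x = exp (- pi * a * x\<^sup>2) * hyp1F1 (- real n) (3/2) (2 * pi * a * x\<^sup>2)"

text \<open>The weight of the theta series in \<open>eps\<close>, for arbitrary \<open>n\<close> so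
  that its integral can be computed by induction on \<open>n\<close>.\<close>

definition kummer_kernel :: "nat \<Rightarrow> real \<Rightarrow> real" where
  "kummer_kernel n t = (t - 1) ^ n / (1 + t) powr (real n + 3/2)"

lemma hyp1F1_terminating:
  "hyp1F1 (- real n) (3/2) z = (\<Sum>m\<le>n. kummer_coeff n m * z ^ m)"
proof -
  have "hyp1F1 (- real n) (3/2) z = (\<Sum>m\<le>n. pochhammer (- real n) m / pochhammer (3/2) m * z ^ m / fact m)"
    unfolding hyp1F1_def by (rule suminf_finite) (auto simp: pochhammer_of_nat_eq_0_lemma)
  then show ?thesis by (simp add: kummer_coeff_def)
qed

lemma hyp2F1_terminating:
  "hyp2F1 (- real n) 1 (3/2) z = (\<Sum>m\<le>n. kummer_coeff n m * fact m * z ^ m)"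
proof -
  have "hyp2F1 (- real n) 1 (3/2) z =
      (\<Sum>m\<le>n. pochhammer (- real n) m * pochhammer 1 m / pochhammer (3/2) m * z ^ m / fact m)"
    unfolding hyp2F1_def by (rule suminf_finite) (auto simp: pochhammer_of_nat_eq_0_lemma)
  then show ?thesis by (simp add: kummer_coeff_def pochhammer_fact[symmetric])
qed

lemma kummer_gauss_altdef:
  "kummer_gauss n a x = (\<Sum>m\<le>n. kummer_coeff n m * (2 * pi * a) ^ m * (exp (- (pi * a) * x\<^sup>2) * x ^ (2 * m)))"
  unfolding kummer_gauss_def hyp1F1_terminating
  by (simp add: sum_distrib_left power_mult[symmetric] power_mult_distrib mult_ac)

lemma kummer_gauss_measurable [measurable]: "kummer_gauss n a \<in> borel_measurable borel"
  unfolding kummer_gauss_altdef by measurable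

lemma set_integral_sum:
  fixes f :: "'i \<Rightarrow> real \<Rightarrow> real"
  assumes "\<And>i. i \<in> I \<Longrightarrow> set_integrable M A (f i)"
  shows "set_integrable M A (\<lambda>x. \<Sum>i\<in>I. f i x)" "(LINT x:A|M. \<Sum>i\<in>I. f i x) = (\<Sum>i\<in>I. LINT x:A|M. f i x)"
  using assms unfolding set_integrable_def set_lebesgue_integral_def
  by (auto simp: sum_distrib_left)

lemma kummer_gauss_integrable:
  assumes a: "a > 0"
  shows "set_integrable lborel {0<..} (\<lambda>x. x ^ p * kummer_gauss n a x)"
proof -
  have "set_integrable lborel {0<..} (\<lambda>x. \<Sum>m\<le>n. kummer_coeff n m * (2 * pi * a) ^ m * (exp (- (pi * a) * x\<^sup>2) * x ^ (p + 2 * m)))"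
    using a by (intro set_integral_sum(1) set_integrable_mult_right gaussian_moments_pos) auto
  then show ?thesis
    unfolding kummer_gauss_altdef by (simp add: sum_distrib_left power_add mult_ac)
qed

text \<open>The odd Gaussian moment contributes \<open>fact m\<close>, turning the Kummer
  coefficients into those of the Gauss function, and a power of \<open>pi * a\<close> that reduces
  \<open>(2 * pi * a) ^ m\<close> to \<open>2 ^ m\<close>; hence the argument 2.\<close>

lemma kummer_gauss_first_moment:
  assumes a: "a > 0"
  shows "(LBINT x:{0<..}. x * kummer_gauss n a x) = hyp2F1 (- real n) 1 (3/2) 2 / (2 * pi * a)"
proof -
  have pa: "pi * a > 0" using a by simp
  have "x * kummer_gauss n a x = (\<Sum>m\<le>n. kummer_coeff n m * (2 * pi * a) ^ m * (exp (- (pi * a) * x\<^sup>2) * x ^ (2 * m + 1)))" for x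
    unfolding kummer_gauss_altdef by (simp add: sum_distrib_left mult_ac)
  then have "(LBINT x:{0<..}. x * kummer_gauss n a x) =
      (\<Sum>m\<le>n. kummer_coeff n m * (2 * pi * a) ^ m * (LBINT x:{0<..}. exp (- (pi * a) * x\<^sup>2) * x ^ (2 * m + 1)))"
    using pa by (simp only: set_integral_sum(2) set_integrable_mult_right gaussian_moments_pos(1) set_integral_mult_right)
  also have "\<dots> = (\<Sum>m\<le>n. kummer_coeff n m * fact m * 2 ^ m / (2 * pi * a))"
  proof (rule sum.cong)
    fix m
    have "(2 * pi * a) ^ m = 2 ^ m * (pi * a) ^ m" by (simp add: power_mult_distrib)
    then show "kummer_coeff n m * (2 * pi * a) ^ m * (LBINT x:{0<..}. exp (- (pi * a) * x\<^sup>2) * x ^ (2 * m + 1)) =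
        kummer_coeff n m * fact m * 2 ^ m / (2 * pi * a)"
      using a unfolding gaussian_moments_pos(3)[OF pa] by (simp add: mult_ac)
  qed simp
  finally show ?thesis by (simp add: hyp2F1_terminating sum_divide_distrib)
qed

text \<open>The exponentials merge into a Gaussian of parameter \<open>pi * a * (1 + t)\<close>. In
  its even moments \<open>pochhammer (3/2) m\<close> cancels, leaving the binomial expansion of the
  \<open>n\<close>-th power of \<open>1 - 2 / (1 + t)\<close>, which is
  \<open>(t - 1) / (1 + t)\<close>.\<close>

lemma kummer_gauss_laplace:
  assumes a: "a > 0" and t: "t > 0"
  shows "(LBINT x:{0<..}. x\<^sup>2 * kummer_gauss n a x * exp (- pi * a * x\<^sup>2 * t)) = kummer_kernel n t / (4 * pi * a * sqrt a)"
proof -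
  define s where "s = pi * a * (1 + t)"
  have s: "s > 0" using a t by (simp add: s_def)
  have exp_eq: "exp (- s * x\<^sup>2) = exp (- (pi * a) * x\<^sup>2) * exp (- pi * a * x\<^sup>2 * t)" for x
    by (simp add: s_def exp_add[symmetric] algebra_simps)
  have eq: "x\<^sup>2 * kummer_gauss n a x * exp (- pi * a * x\<^sup>2 * t) =
      (\<Sum>m\<le>n. kummer_coeff n m * (2 * pi * a) ^ m * (exp (- s * x\<^sup>2) * x ^ (2 * m + 2)))" for x
    unfolding kummer_gauss_altdef sum_distrib_left sum_distrib_right
    by (intro sum.cong refl) (simp only: exp_eq power_add mult_ac)
  define u where "u = - 2 / (1 + t)"
  have "(LBINT x:{0<..}. x\<^sup>2 * kummer_gauss n a x * exp (- pi * a * x\<^sup>2 * t)) =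
      (\<Sum>m\<le>n. kummer_coeff n m * (2 * pi * a) ^ m * (LBINT x:{0<..}. exp (- s * x\<^sup>2) * x ^ (2 * m + 2)))"
    unfolding eq using s by (simp only: set_integral_sum(2) set_integrable_mult_right gaussian_moments_pos(1) set_integral_mult_right)
  also have "\<dots> = (\<Sum>m\<le>n. sqrt pi / (4 * s * sqrt s) * (real (n choose m) * u ^ m * 1 ^ (n - m)))"
  proof (rule sum.cong)
    fix m
    have "kummer_coeff n m * pochhammer (3/2) m = pochhammer (- real n) m / fact m"
      using pochhammer_pos[of "3/2::real" m] by (simp add: kummer_coeff_def)
    also have "\<dots> = (- 1) ^ m * real (n choose m)"
      by (simp add: binomial_gbinomial gbinomial_pochhammer power_mult_distrib[symmetric])
    finally have c: "kummer_coeff n m * pochhammer (3/2) m = (- 1) ^ m * real (n choose m)" .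
    have u: "(2 * pi * a) ^ m / s ^ m = (- 1) ^ m * u ^ m"
      unfolding power_divide[symmetric] power_mult_distrib[symmetric] u_def s_def using a t by simp
    have "kummer_coeff n m * (2 * pi * a) ^ m * (LBINT x:{0<..}. exp (- s * x\<^sup>2) * x ^ (2 * m + 2)) =
        (kummer_coeff n m * pochhammer (3/2) m) * ((2 * pi * a) ^ m / s ^ m) * (sqrt pi / (4 * s * sqrt s))"
      unfolding gaussian_moments_pos(2)[OF s] by (simp add: mult_ac)
    also have "\<dots> = ((- 1) ^ m * (- 1) ^ m) * (sqrt pi / (4 * s * sqrt s) * (real (n choose m) * u ^ m * 1 ^ (n - m)))"
      unfolding c u by simp
    finally show "kummer_coeff n m * (2 * pi * a) ^ m * (LBINT x:{0<..}. exp (- s * x\<^sup>2) * x ^ (2 * m + 2)) =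
        sqrt pi / (4 * s * sqrt s) * (real (n choose m) * u ^ m * 1 ^ (n - m))"
      by (simp add: power_mult_distrib[symmetric])
  qed simp
  also have "\<dots> = sqrt pi / (4 * s * sqrt s) * (u + 1) ^ n"
    by (simp add: binomial_ring sum_distrib_left)
  also have "u + 1 = (t - 1) / (1 + t)" using t by (simp add: u_def field_simps)
  also have "sqrt pi / (4 * s * sqrt s) * ((t - 1) / (1 + t)) ^ n =
      (t - 1) ^ n / ((1 + t) ^ n * ((1 + t) * sqrt (1 + t))) / (4 * pi * a * sqrt a)"
    using a t by (simp add: s_def real_sqrt_mult power_divide)
  also have "(1 + t) ^ n * ((1 + t) * sqrt (1 + t)) = (1 + t) powr (real n + 3/2)"
  proof -
    have "real n + 3/2 = real n + (1 + 1/2)" by simp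
    then show ?thesis
      using t by (simp only: powr_add) (simp add: powr_realpow powr_half_sqrt)
  qed
  finally show "(LBINT x:{0<..}. x\<^sup>2 * kummer_gauss n a x * exp (- pi * a * x\<^sup>2 * t)) = kummer_kernel n t / (4 * pi * a * sqrt a)"
    by (simp add: kummer_kernel_def)
qed

section \<open>Laplace transforms and total mass of the kernel\<close>

lemma kummer_kernel_measurable [measurable]: "kummer_kernel n \<in> borel_measurable borel"
  unfolding kummer_kernel_def by measurable

text \<open>Up to the factor \<open>pi * a\<close>, the fraction
  \<open>1 / (x\<^sup>2 + c\<^sup>2)\<close> is the integral of
  \<open>exp (- pi * a * (x\<^sup>2 + c\<^sup>2) * t)\<close> over \<open>t\<close>, so Fubini
  exchanges it with the Laplace transform in \<open>x\<close>. Positive integers \<open>c\<close>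
  give the terms of \<open>phi_theta\<close>, and \<open>c = 0\<close> gives the integral of the
  kernel itself.\<close>

lemma kummer_kernel_laplace:
  fixes c :: real
  assumes a: "a > 0"
  shows "set_integrable lborel {0<..} (\<lambda>x. x\<^sup>2 * kummer_gauss n a x / (x\<^sup>2 + c\<^sup>2))"
    and "set_integrable lborel {0<..} (\<lambda>t. exp (- pi * c\<^sup>2 * a * t) * kummer_kernel n t)"
    and "(LBINT t:{0<..}. exp (- pi * c\<^sup>2 * a * t) * kummer_kernel n t) =
         4 * sqrt a * (LBINT x:{0<..}. x\<^sup>2 * kummer_gauss n a x / (x\<^sup>2 + c\<^sup>2))"
proof -
  define E where "E = kummer_gauss n a"
  have [measurable]: "E \<in> borel_measurable borel" by (simp add: E_def)
  define b where "b x = pi * a * (x\<^sup>2 + c\<^sup>2)" for x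
  have b: "b x > 0" if "x > 0" for x
    unfolding b_def using that a by (intro mult_pos_pos add_pos_nonneg) auto
  \<comment> \<open>Integrating this over \<open>t\<close> produces the rational weight, integrating
    it over \<open>x\<close> produces the kernel.\<close>
  define f where "f x t = indicator {0<..} x * (x\<^sup>2 * E x) * (indicator {0<..} t * exp (- b x * t))" for x t
  have inner: "integrable lborel (\<lambda>t. indicator {0<..} t * exp (- b x * t))"
      "(LBINT t. indicator {0<..} t * exp (- b x * t)) = 1 / b x" if "x > 0" for x
    using exp_neg_integral[OF b[OF that]] by (auto simp: set_integrable_def set_lebesgue_integral_def)
  \<comment> \<open>\<open>E\<close> is a majorant for every \<open>c\<close>, including 0, since
    the factor \<open>x\<^sup>2\<close> keeps the quotient
    \<open>x\<^sup>2 / (x\<^sup>2 + c\<^sup>2)\<close> at most 1.\<close>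
  have "set_integrable lborel {0<..} E"
    using kummer_gauss_integrable[OF a, where p=0] by (simp add: E_def)
  then have "set_integrable lborel {0<..} (\<lambda>x. \<bar>x\<^sup>2 * E x / (x\<^sup>2 + c\<^sup>2)\<bar>)"
  proof (rule set_integrable_bound)
    show "set_borel_measurable lborel {0<..} (\<lambda>x. \<bar>x\<^sup>2 * E x / (x\<^sup>2 + c\<^sup>2)\<bar>)"
      by (simp add: set_borel_measurable_def)
    show "AE x in lborel. x \<in> {0<..} \<longrightarrow> norm \<bar>x\<^sup>2 * E x / (x\<^sup>2 + c\<^sup>2)\<bar> \<le> norm (E x)"
    proof (intro AE_I2 impI)
      fix x :: real assume "x \<in> {0<..}"
      then have "x\<^sup>2 + c\<^sup>2 > 0" by (auto intro!: add_pos_nonneg)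
      then have "x\<^sup>2 / (x\<^sup>2 + c\<^sup>2) \<le> 1" by simp
      then have "x\<^sup>2 / (x\<^sup>2 + c\<^sup>2) * \<bar>E x\<bar> \<le> 1 * \<bar>E x\<bar>" by (intro mult_right_mono) auto
      then show "norm \<bar>x\<^sup>2 * E x / (x\<^sup>2 + c\<^sup>2)\<bar> \<le> norm (E x)" by (simp add: abs_mult)
    qed
  qed
  then have absint: "integrable lborel (\<lambda>x. indicator {0<..} x * \<bar>x\<^sup>2 * E x / (x\<^sup>2 + c\<^sup>2)\<bar>)"
    by (simp add: set_integrable_def)
  show int1: "set_integrable lborel {0<..} (\<lambda>x. x\<^sup>2 * kummer_gauss n a x / (x\<^sup>2 + c\<^sup>2))"
    unfolding set_integrable_def E_def[symmetric]
    by (rule Bochner_Integration.integrable_bound[OF absint]) (auto simp: indicator_def)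
  have int: "integrable (lborel \<Otimes>\<^sub>M lborel) (\<lambda>(x, t). f x t)"
  proof (rule lborel_pair.Fubini_integrable)
    show "(\<lambda>(x, t). f x t) \<in> borel_measurable (lborel \<Otimes>\<^sub>M lborel)"
      unfolding f_def b_def by measurable
    have "(LBINT t. norm (case (x, t) of (x, t) \<Rightarrow> f x t)) =
        indicator {0<..} x * \<bar>x\<^sup>2 * E x / (x\<^sup>2 + c\<^sup>2)\<bar> / (pi * a)" for x
    proof (cases "x > 0")
      case True
      have "(LBINT t. norm (case (x, t) of (x, t) \<Rightarrow> f x t)) =
          (LBINT t. \<bar>x\<^sup>2 * E x\<bar> * (indicator {0<..} t * exp (- b x * t)))"
        using True by (intro Bochner_Integration.integral_cong) (auto simp: f_def abs_mult)
      also have "\<dots> = \<bar>x\<^sup>2 * E x\<bar> / b x" by (simp only: integral_mult_right_zero inner(2)[OF True]) simp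
      also have "\<dots> = indicator {0<..} x * \<bar>x\<^sup>2 * E x / (x\<^sup>2 + c\<^sup>2)\<bar> / (pi * a)"
        using True a by (simp add: b_def abs_mult)
      finally show ?thesis .
    qed (simp add: f_def)
    then show "integrable lborel (\<lambda>x. LBINT t. norm (case (x, t) of (x, t) \<Rightarrow> f x t))"
      using integrable_divide[OF absint, of "pi * a"] by (simp only:)
    show "AE x in lborel. integrable lborel (\<lambda>t. case (x, t) of (x, t) \<Rightarrow> f x t)"
    proof (rule AE_I2)
      fix x :: real
      show "integrable lborel (\<lambda>t. case (x, t) of (x, t) \<Rightarrow> f x t)"
      proof (cases "x > 0")
        case True
        then show ?thesis unfolding f_def prod.case by (intro integrable_mult_right inner(1))
      qed (simp add: f_def)
    qed
  qed
  have ft: "(LBINT t. f x t) = indicator {0<..} x * (x\<^sup>2 * E x / (x\<^sup>2 + c\<^sup>2)) / (pi * a)" for x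
  proof (cases "x > 0")
    case True
    have "(LBINT t. f x t) = x\<^sup>2 * E x / b x"
      unfolding f_def by (simp only: integral_mult_right_zero inner(2)[OF True]) (simp add: True)
    then show ?thesis using True by (simp add: b_def)
  qed (simp add: f_def)
  have fx: "(LBINT x. f x t) = indicator {0<..} t * (exp (- pi * c\<^sup>2 * a * t) * kummer_kernel n t) / (4 * pi * a * sqrt a)" for t
  proof (cases "t > 0")
    case True
    have "f x t = exp (- pi * c\<^sup>2 * a * t) * (indicator {0<..} x * (x\<^sup>2 * E x * exp (- pi * a * x\<^sup>2 * t)))" for x
    proof -
      have "exp (- b x * t) = exp (- pi * c\<^sup>2 * a * t) * exp (- pi * a * x\<^sup>2 * t)"
        by (simp add: b_def exp_add[symmetric] algebra_simps)
      then show ?thesis using True by (simp add: f_def)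
    qed
    then have "(LBINT x. f x t) = exp (- pi * c\<^sup>2 * a * t) * (LBINT x:{0<..}. x\<^sup>2 * E x * exp (- pi * a * x\<^sup>2 * t))"
      by (simp add: set_lebesgue_integral_def)
    then show ?thesis using kummer_gauss_laplace[OF a True, of n] True by (simp add: E_def)
  qed (simp add: f_def)
  \<comment> \<open>Integrability in \<open>t\<close> is a by-product of Fubini, because the inner
    integral is a constant multiple of the damped kernel on the positive half-line.\<close>
  have "integrable lborel (\<lambda>t. 4 * pi * a * sqrt a * (LBINT x. f x t))"
    using lborel_pair.integrable_snd[OF int] by (intro integrable_mult_right) simp
  then show "set_integrable lborel {0<..} (\<lambda>t. exp (- pi * c\<^sup>2 * a * t) * kummer_kernel n t)"
    using a unfolding fx set_integrable_def by simp
  have "(LBINT t. LBINT x. f x t) = (LBINT x. LBINT t. f x t)"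
    by (rule lborel_pair.Fubini_integral[OF int])
  then have "(LBINT t:{0<..}. exp (- pi * c\<^sup>2 * a * t) * kummer_kernel n t) / (4 * pi * a * sqrt a) =
      (LBINT x:{0<..}. x\<^sup>2 * E x / (x\<^sup>2 + c\<^sup>2)) / (pi * a)"
    unfolding ft fx set_lebesgue_integral_def real_scaleR_def by (simp only: integral_divide_zero)
  then show "(LBINT t:{0<..}. exp (- pi * c\<^sup>2 * a * t) * kummer_kernel n t) =
         4 * sqrt a * (LBINT x:{0<..}. x\<^sup>2 * kummer_gauss n a x / (x\<^sup>2 + c\<^sup>2))"
    using a by (simp add: E_def field_simps)
qed

text \<open>A Beta integral with parameters \<open>n + 1\<close> and 1/2, which supplies the Gamma
  quotient in \<open>T\<close>.\<close>

lemma kummer_kernel_integral: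
  "(LBINT t:{1<..}. kummer_kernel n t) = sqrt (pi / 2) * Gamma (real n + 1) / Gamma (real n + 3/2)"
proof -
  have int: "set_integrable lborel {1<..} (kummer_kernel n)" for n
    by (rule set_integrable_subset[of _ "{0<..}"])
       (use kummer_kernel_laplace(2)[where a = 1 and c = 0 and n = n] in auto)
  have ein: "einterval 1 \<infinity> = {1<..}" by (auto simp: einterval_def)
  have Gamma_rec: "Gamma (z + 1) = z * Gamma z" if "z > 0" for z :: real
    using that nonpos_Ints_nonpos[of z] by (intro Gamma_plus1) auto
  have lim: "((\<lambda>t::real. (1 + t) powr (- 1/2)) \<longlongrightarrow> 0) at_top"
    by (rule tendsto_neg_powr)
       (auto intro!: filterlim_tendsto_add_at_top[OF tendsto_const] filterlim_ident)
  \<comment> \<open>The recurrence in \<open>n\<close> comes from integrating the derivative of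
    \<open>(t - 1) ^ (n + 1) * (1 + t) powr - (n + 3/2)\<close>, which vanishes at both ends.\<close>
  show "(LBINT t:{1<..}. kummer_kernel n t) = sqrt (pi / 2) * Gamma (real n + 1) / Gamma (real n + 3/2)"
  proof (induction n)
    case 0
    have "(LBINT t=1..\<infinity>. kummer_kernel 0 t) = 0 - (- sqrt 2)"
    proof (rule interval_integral_FTC_integrable[where F = "\<lambda>t. - 2 * (1 + t) powr (- 1/2)"])
      show "((\<lambda>t. - 2 * (1 + t) powr (- 1/2)) has_vector_derivative kummer_kernel 0 x) (at x)" if "1 < ereal x" for x
      proof -
        have "((\<lambda>t. - 2 * (1 + t) powr (- 1/2)) has_real_derivative - 2 * (- 1/2 * (1 + x) powr (- 1/2 - 1))) (at x)"
          using that by (auto intro!: derivative_eq_intros)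
        moreover have "- 2 * (- 1/2 * (1 + x) powr (- 1/2 - 1)) = kummer_kernel 0 x"
          by (simp add: kummer_kernel_def powr_minus_divide)
        ultimately show ?thesis by (simp only: has_real_derivative_iff_has_vector_derivative[symmetric])
      qed
      show "isCont (kummer_kernel 0) x" if "1 < ereal x" for x
        unfolding kummer_kernel_def using that by (auto intro!: continuous_intros)
      show "set_integrable lborel (einterval 1 \<infinity>) (kummer_kernel 0)" unfolding ein by (rule int)
      have "((\<lambda>t::real. - 2 * (1 + t) powr (- 1/2)) \<longlongrightarrow> - 2 * (1 + 1) powr (- 1/2)) (at_right 1)"
        by (intro tendsto_intros) auto
      moreover have "- 2 * (1 + 1) powr (- 1/2) = - sqrt (2::real)"
        by (simp add: powr_minus powr_half_sqrt field_simps)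
      ultimately show "(((\<lambda>t. - 2 * (1 + t) powr (- 1/2)) \<circ> real_of_ereal) \<longlongrightarrow> - sqrt 2) (at_right 1)"
        by (simp add: ereal_tendsto_simps one_ereal_def)
      have "((\<lambda>t::real. - 2 * (1 + t) powr (- 1/2)) \<longlongrightarrow> - 2 * 0) at_top"
        by (intro tendsto_mult tendsto_const lim)
      then show "(((\<lambda>t. - 2 * (1 + t) powr (- 1/2)) \<circ> real_of_ereal) \<longlongrightarrow> 0) (at_left \<infinity>)"
        by (simp add: ereal_tendsto_simps)
    qed auto
    then have "(LBINT t:{1<..}. kummer_kernel 0 t) = 2 / sqrt 2"
      by (simp add: interval_lebesgue_integral_def ein real_div_sqrt)
    moreover have G: "Gamma (3/2 :: real) = sqrt pi / 2"
      using Gamma_rec[of "1/2"] Gamma_one_half_real by simp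
    have "sqrt (pi / 2) * Gamma (real 0 + 1) / Gamma (real 0 + 3/2) = 2 / sqrt 2"
      by (simp add: G real_sqrt_divide)
    ultimately show ?case by simp
  next
    case (Suc n)
    define P where "P t = (t - 1) ^ (n + 1) * (1 + t) powr (- (real n + 3/2))" for t :: real
    have "(LBINT t=1..\<infinity>. real (n + 1) * kummer_kernel n t - (real n + 3/2) * kummer_kernel (Suc n) t) = 0 - 0"
    proof (rule interval_integral_FTC_integrable[where F = P])
      show "(P has_vector_derivative real (n + 1) * kummer_kernel n x - (real n + 3/2) * kummer_kernel (Suc n) x) (at x)"
        if "1 < ereal x" for x
      proof -
        have x: "x > 1" using that by simp
        have "((\<lambda>t. (t - 1) ^ Suc n) has_real_derivative (1 + real n) * (1 * (x - 1) ^ n)) (at x)"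
          by (intro DERIV_power_Suc) (auto intro!: derivative_eq_intros)
        moreover have "((\<lambda>t. (1 + t) powr (- (real n + 3/2))) has_real_derivative
            - (real n + 3/2) * (1 + x) powr (- (real n + 3/2) - 1)) (at x)"
          using x by (auto intro!: derivative_eq_intros)
        ultimately have "(P has_real_derivative (1 + real n) * (1 * (x - 1) ^ n) * (1 + x) powr (- (real n + 3/2)) +
            (- (real n + 3/2) * (1 + x) powr (- (real n + 3/2) - 1)) * (x - 1) ^ Suc n) (at x)"
          unfolding P_def Suc_eq_plus1[symmetric] by (rule DERIV_mult)
        moreover have "- (real n + 3/2) - 1 = - (real (Suc n) + 3/2)" by simp
        then have "(1 + x) powr (- (real n + 3/2) - 1) = 1 / (1 + x) powr (real (Suc n) + 3/2)"
          by (simp only: powr_minus_divide)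
        moreover have "(1 + r) * (1 * p) * (1 / A) + (- c * (1 / B)) * q = (r + 1) * (p / A) - c * (q / B)"
          for r p A c B q :: real
          by (simp add: add.commute)
        ultimately show ?thesis
          by (simp only: has_real_derivative_iff_has_vector_derivative[symmetric] kummer_kernel_def
              powr_minus_divide of_nat_add of_nat_1)
      qed
      show "isCont (\<lambda>t. real (n + 1) * kummer_kernel n t - (real n + 3/2) * kummer_kernel (Suc n) t) x" if "1 < ereal x" for x
        unfolding kummer_kernel_def using that by (auto intro!: continuous_intros)
      show "set_integrable lborel (einterval 1 \<infinity>) (\<lambda>t. real (n + 1) * kummer_kernel n t - (real n + 3/2) * kummer_kernel (Suc n) t)"
        unfolding ein by (intro set_integral_diff set_integrable_mult_right int)
      have "(P \<longlongrightarrow> (1 - 1) ^ (n + 1) * (1 + 1) powr (- (real n + 3/2))) (at_right 1)"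
        unfolding P_def by (intro tendsto_intros) auto
      then show "((P \<circ> real_of_ereal) \<longlongrightarrow> 0) (at_right 1)"
        by (simp add: ereal_tendsto_simps one_ereal_def)
      have "(P \<longlongrightarrow> 0) at_top"
      \<comment> \<open>Replacing \<open>t - 1\<close> by \<open>t + 1\<close> leaves total exponent
        \<open>(n + 1) - (n + 3/2)\<close>, that is -1/2.\<close>
      proof (rule tendsto_sandwich)
        show "eventually (\<lambda>t. 0 \<le> P t) at_top"
          using eventually_ge_at_top[of 1] by eventually_elim (simp add: P_def)
        show "eventually (\<lambda>t. P t \<le> (1 + t) powr (- 1/2)) at_top"
          using eventually_ge_at_top[of 1]
        proof eventually_elim
          case (elim t)
          have "P t \<le> (1 + t) ^ (n + 1) * (1 + t) powr (- (real n + 3/2))"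
            unfolding P_def using elim by (intro mult_right_mono power_mono) auto
          also have "\<dots> = (1 + t) powr (real (n + 1) + - (real n + 3/2))"
            unfolding powr_add using elim powr_realpow[of "1 + t" "n + 1"] by simp
          finally show ?case by simp
        qed
        show "((\<lambda>t::real. (1 + t) powr (- 1/2)) \<longlongrightarrow> 0) at_top" by (rule lim)
      qed auto
      then show "((P \<circ> real_of_ereal) \<longlongrightarrow> 0) (at_left \<infinity>)"
        by (simp add: ereal_tendsto_simps)
    qed auto
    then have "real (n + 1) * (LBINT t:{1<..}. kummer_kernel n t) = (real n + 3/2) * (LBINT t:{1<..}. kummer_kernel (Suc n) t)"
      by (simp add: interval_lebesgue_integral_def ein set_integral_diff(2) int)
    moreover have "real n + 3/2 \<noteq> 0" by linarith
    ultimately have "(LBINT t:{1<..}. kummer_kernel (Suc n) t) = real (n + 1) * (LBINT t:{1<..}. kummer_kernel n t) / (real n + 3/2)"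
      by (metis nonzero_mult_div_cancel_left)
    also have "\<dots> = sqrt (pi / 2) * ((real n + 1) * Gamma (real n + 1)) / ((real n + 3/2) * Gamma (real n + 3/2))"
      unfolding Suc by (simp only: times_divide_eq_right divide_divide_eq_left mult_ac of_nat_add of_nat_1)
    also have "(real n + 1) * Gamma (real n + 1) = Gamma (real (Suc n) + 1)"
      using Gamma_rec[of "real n + 1"] by (simp add: add_ac)
    also have "(real n + 3/2) * Gamma (real n + 3/2) = Gamma (real (Suc n) + 3/2)"
      using Gamma_rec[of "real n + 3/2"] by (simp add: add_ac)
    finally show ?case .
  qed
qed

subsection \<open>Summation over the lattice and inversion\<close>

lemma set_integral_suminf:
  fixes f :: "nat \<Rightarrow> 'a \<Rightarrow> real"
  assumes int: "\<And>i. set_integrable M A (f i)"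
    and summ: "\<And>x. x \<in> A \<Longrightarrow> summable (\<lambda>i. \<bar>f i x\<bar>)"
    and summ': "summable (\<lambda>i. LINT x:A|M. \<bar>f i x\<bar>)"
  shows "set_integrable M A (\<lambda>x. \<Sum>i. f i x)"
    and "(LINT x:A|M. \<Sum>i. f i x) = (\<Sum>i. LINT x:A|M. f i x)"
proof -
  let ?g = "\<lambda>i x. indicator A x *\<^sub>R f i x"
  have eq: "(\<Sum>i. ?g i x) = indicator A x *\<^sub>R (\<Sum>i. f i x)" for x
    by (cases "x \<in> A") auto
  have 1: "\<And>i. integrable M (?g i)" using int by (simp add: set_integrable_def)
  have 2: "AE x in M. summable (\<lambda>i. norm (?g i x))"
  proof (rule AE_I2)
    fix x show "summable (\<lambda>i. norm (?g i x))" using summ[of x] by (cases "x \<in> A") auto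
  qed
  have 3: "summable (\<lambda>i. LINT x|M. norm (?g i x))"
    using summ' by (simp add: set_lebesgue_integral_def abs_mult)
  show "set_integrable M A (\<lambda>x. \<Sum>i. f i x)"
    using integrable_suminf[OF 1 2 3] by (simp only: eq set_integrable_def)
  show "(LINT x:A|M. \<Sum>i. f i x) = (\<Sum>i. LINT x:A|M. f i x)"
    using integral_suminf[OF 1 2 3] by (simp only: eq set_lebesgue_integral_def)
qed

lemma kummer_kernel_nonneg: "even n \<Longrightarrow> 0 \<le> kummer_kernel n t"
  by (simp add: kummer_kernel_def zero_le_even_power)

text \<open>Clearing \<open>u\<close> from numerator and denominator leaves \<open>u\<close> to the
  power 3/2; evenness of \<open>n\<close> absorbs the sign change from \<open>u - 1\<close> to
  \<open>1 - u\<close>.\<close>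

lemma kummer_kernel_inverse:
  assumes "even n" "u > 0"
  shows "kummer_kernel n (1 / u) = u * sqrt u * kummer_kernel n u"
proof -
  have eqs: "1 / u - 1 = (1 - u) / u" "1 + 1 / u = (1 + u) / u" using assms by (simp_all add: field_simps)
  have "u powr (real n + (1 + 1/2)) = u ^ n * (u * sqrt u)"
    using assms by (simp only: powr_add) (simp add: powr_realpow powr_half_sqrt)
  then have "u powr (real n + 3/2) = u ^ n * (u * sqrt u)" by simp
  moreover have "(1 - u) ^ n = (u - 1) ^ n"
    using assms by (metis minus_diff_eq power_minus_even)
  ultimately show ?thesis
    unfolding kummer_kernel_def eqs using assms by (simp add: power_divide powr_divide)
qed

text \<open>The theta transformation at \<open>a / u\<close>. Adding 1/2 completes each one-sided
  sum to half of the two-sided theta series, which is what transforms without a remainder.\<close>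

lemma phi_theta_inverse:
  assumes a: "a > 0" and u: "u > 0"
  shows "sqrt a * (phi_theta a (1 / u) + 1/2) = sqrt u * (psi_theta a u + 1/2)"
proof -
  have "1 + 2 * phi_theta a (1 / u) = (1 + 2 * psi_theta a u) / sqrt (a / u)"
    using theta_transformation[of "a / u"] a u unfolding phi_theta_def psi_theta_def
    by (simp add: mult_ac)
  then show ?thesis using a u by (simp add: real_sqrt_divide field_simps)
qed

lemma theta_measurable [measurable]:
  "phi_theta a \<in> borel_measurable borel" "psi_theta a \<in> borel_measurable borel"
  unfolding phi_theta_def psi_theta_def by measurable

text \<open>\<open>kummer_kernel_laplace\<close> is summed over the positive integers
  \<open>c\<close>. The partial fractions of coth then split the integrand in \<open>x\<close> into
  three parts: \<open>B\<close>, the first moment giving the Gauss function, and the plain integral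
  of \<open>E\<close>, which is the case \<open>c = 0\<close> read backwards.\<close>

lemma phi_kummer_kernel_integral:
  assumes a: "a > 0" and n: "even n"
  defines "B \<equiv> (\<lambda>x. x * kummer_gauss n a x / (exp (2 * pi * x) - 1))"
  shows "set_integrable lborel {0<..} (\<lambda>t. phi_theta a t * kummer_kernel n t)"
    and "(LBINT t:{0<..}. phi_theta a t * kummer_kernel n t) =
           4 * pi * sqrt a * (LBINT x:{0<..}. B x) + hyp2F1 (- real n) 1 (3/2) 2 / sqrt a
           - (LBINT t:{0<..}. kummer_kernel n t) / 2"
proof -
  define E where "E = kummer_gauss n a"
  have [measurable]: "E \<in> borel_measurable borel" by (simp add: E_def)
  define f where "f i t = exp (- pi * (real (Suc i))\<^sup>2 * a * t) * kummer_kernel n t" for i t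
  define g where "g i x = x\<^sup>2 * E x / (x\<^sup>2 + (real (Suc i))\<^sup>2)" for i x
  have f: "set_integrable lborel {0<..} (f i)" for i
    unfolding f_def by (rule kummer_kernel_laplace(2)[OF a])
  have g: "set_integrable lborel {0<..} (g i)" for i
    unfolding g_def E_def by (rule kummer_kernel_laplace(1)[OF a])
  have fg: "(LBINT t:{0<..}. f i t) = 4 * sqrt a * (LBINT x:{0<..}. g i x)" for i
    unfolding f_def g_def E_def by (rule kummer_kernel_laplace(3)[OF a])
  have Ep: "set_integrable lborel {0<..} (\<lambda>x. x ^ p * E x)" for p
    unfolding E_def by (rule kummer_gauss_integrable[OF a])
  \<comment> \<open>Bounding \<open>1 / (x\<^sup>2 + N\<^sup>2)\<close> by
    \<open>1 / N\<^sup>2\<close> makes the absolute integrals of the \<open>g i\<close>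
    summable.\<close>
  define D where "D = (LBINT x:{0<..}. \<bar>x\<^sup>2 * E x\<bar>)"
  have gle: "\<bar>g i x\<bar> \<le> \<bar>x\<^sup>2 * E x\<bar> * (1 / (real (Suc i))\<^sup>2)" for i x
    unfolding g_def abs_divide by (auto intro!: frac_le)
  have sD: "summable (\<lambda>i. D * (1 / (real (Suc i))\<^sup>2))"
    by (intro summable_mult summable_inverse_Suc_sq)
  have gD: "(LBINT x:{0<..}. \<bar>g i x\<bar>) \<le> D * (1 / (real (Suc i))\<^sup>2)" for i
  proof -
    have "(LBINT x:{0<..}. \<bar>g i x\<bar>) \<le> (LBINT x:{0<..}. \<bar>x\<^sup>2 * E x\<bar> * (1 / (real (Suc i))\<^sup>2))"
      by (intro set_integral_mono set_integrable_abs set_integrable_mult_left g Ep gle)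
    then show ?thesis by (simp add: D_def)
  qed
  have sg: "summable (\<lambda>i. LBINT x:{0<..}. \<bar>g i x\<bar>)"
  proof (rule summable_comparison_test'[OF sD])
    have "0 \<le> (LBINT x:{0<..}. \<bar>g i x\<bar>)" for i
      unfolding set_lebesgue_integral_def by (intro Bochner_Integration.integral_nonneg) auto
    then show "norm (LBINT x:{0<..}. \<bar>g i x\<bar>) \<le> D * (1 / (real (Suc i))\<^sup>2)" for i
      using gD[of i] by simp
  qed
  have "\<bar>LBINT x:{0<..}. g i x\<bar> \<le> (LBINT x:{0<..}. \<bar>g i x\<bar>)" for i
    using set_integral_norm_bound[OF g[of i]] by simp
  then have "summable (\<lambda>i. LBINT x:{0<..}. g i x)"
    by (intro summable_comparison_test'[OF sg]) auto
  then have sf: "summable (\<lambda>i. LBINT t:{0<..}. f i t)"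
    unfolding fg by (rule summable_mult)
  \<comment> \<open>For even \<open>n\<close> the terms are nonnegative, so the summability carried
    over from the \<open>g i\<close> is already absolute and no estimate of the \<open>f i\<close>
    is required.\<close>
  have f_abs: "\<bar>f i t\<bar> = f i t" for i t using kummer_kernel_nonneg[OF n] by (simp add: f_def)
  have summ_exp: "summable (\<lambda>i. exp (- pi * (real (Suc i))\<^sup>2 * a * t))" if "t > 0" for t
  proof (subst summable_Suc_iff)
    show "summable (\<lambda>i. exp (- pi * (real i)\<^sup>2 * a * t))"
      using summable_exp_neg_sq[of "pi * a * t"] a that by (simp add: mult_ac)
  qed
  have f_suminf: "(\<Sum>i. f i t) = phi_theta a t * kummer_kernel n t" if "t \<in> {0<..}" for t
    unfolding f_def phi_theta_def by (rule suminf_mult2[OF summ_exp, symmetric]) (use that in simp)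
  have f_summable: "summable (\<lambda>i. \<bar>f i t\<bar>)" if "t \<in> {0<..}" for t
    unfolding f_abs unfolding f_def using that by (intro summable_mult2 summ_exp) auto
  have F: "set_integrable lborel {0<..} (\<lambda>t. \<Sum>i. f i t)"
      "(LBINT t:{0<..}. \<Sum>i. f i t) = (\<Sum>i. LBINT t:{0<..}. f i t)"
    by (rule set_integral_suminf[OF f f_summable]; simp add: f_abs sf)+
  show "set_integrable lborel {0<..} (\<lambda>t. phi_theta a t * kummer_kernel n t)"
    using F(1) by (rule set_integrable_cong[THEN iffD1, rotated -1]) (auto simp: f_suminf)
  have g_summable: "summable (\<lambda>i. \<bar>g i x\<bar>)" for x
    by (rule summable_comparison_test'[OF summable_mult[OF summable_inverse_Suc_sq, of "\<bar>x\<^sup>2 * E x\<bar>"]])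
       (use gle in auto)
  have g_suminf: "(\<Sum>i. g i x) = pi * B x + (pi / 2) * (x ^ 1 * E x) - 1/2 * (x ^ 0 * E x)" if "x \<in> {0<..}" for x
  proof -
    have "(\<Sum>i. g i x) = (\<Sum>i. (x\<^sup>2 * E x) * (1 / (x\<^sup>2 + (real (Suc i))\<^sup>2)))" by (simp add: g_def)
    also have "\<dots> = (x\<^sup>2 * E x) * (\<Sum>i. 1 / (x\<^sup>2 + (real (Suc i))\<^sup>2))"
      by (rule suminf_mult) (rule summable_inverse_sq_add)
    also have "\<dots> = x * E x * (x * (\<Sum>i. 1 / (x\<^sup>2 + (real (Suc i))\<^sup>2)))" by (simp add: power2_eq_square)
    also have "x * (\<Sum>i. 1 / (x\<^sup>2 + (real (Suc i))\<^sup>2)) = pi * (1 / (exp (2 * pi * x) - 1) + 1/2 - 1 / (2 * pi * x))"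
      using that by (intro coth_partial_fractions) auto
    also have "x * E x * \<dots> = pi * B x + (pi / 2) * (x ^ 1 * E x) - 1/2 * (x ^ 0 * E x)"
      using that by (simp add: B_def E_def algebra_simps)
    finally show ?thesis .
  qed
  have G: "set_integrable lborel {0<..} (\<lambda>x. \<Sum>i. g i x)"
      "(LBINT x:{0<..}. \<Sum>i. g i x) = (\<Sum>i. LBINT x:{0<..}. g i x)"
    by (rule set_integral_suminf[OF g g_summable sg])+
  \<comment> \<open>Solving the partial fraction identity for \<open>B\<close> gives its
    integrability without estimates near 0 or infinity.\<close>
  have "set_integrable lborel {0<..} (\<lambda>x. 1 / pi * ((\<Sum>i. g i x) - (pi / 2) * (x ^ 1 * E x) + 1/2 * (x ^ 0 * E x)))"
    by (intro set_integrable_mult_right set_integral_add(1) set_integral_diff(1) G(1) Ep)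
  then have B: "set_integrable lborel {0<..} B"
    by (rule set_integrable_cong[THEN iffD1, rotated -1]) (auto simp: g_suminf)
  have "(LBINT t:{0<..}. phi_theta a t * kummer_kernel n t) = (LBINT t:{0<..}. \<Sum>i. f i t)"
    by (rule set_lebesgue_integral_cong) (auto simp: f_suminf)
  also have "\<dots> = 4 * sqrt a * (\<Sum>i. LBINT x:{0<..}. g i x)"
    unfolding F(2) fg by (rule suminf_mult) fact
  also have "(\<Sum>i. LBINT x:{0<..}. g i x) =
      (LBINT x:{0<..}. pi * B x + (pi / 2) * (x ^ 1 * E x) - 1/2 * (x ^ 0 * E x))"
    unfolding G(2)[symmetric] by (rule set_lebesgue_integral_cong) (auto simp: g_suminf)
  also have "\<dots> = pi * (LBINT x:{0<..}. B x) + pi / 2 * (LBINT x:{0<..}. x ^ 1 * E x) - 1/2 * (LBINT x:{0<..}. x ^ 0 * E x)"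
    by (simp only: set_integral_add set_integral_diff set_integrable_mult_right set_integral_mult_right B Ep)
  also have "(LBINT x:{0<..}. x ^ 1 * E x) = hyp2F1 (- real n) 1 (3/2) 2 / (2 * pi * a)"
    using kummer_gauss_first_moment[OF a, of n] by (simp add: E_def)
  also have "(LBINT x:{0<..}. x ^ 0 * E x) = (LBINT t:{0<..}. kummer_kernel n t) / (4 * sqrt a)"
  proof -
    have "(LBINT x:{0<..}. x\<^sup>2 * E x / (x\<^sup>2 + 0\<^sup>2)) = (LBINT x:{0<..}. x ^ 0 * E x)"
      by (rule set_lebesgue_integral_cong) auto
    then show ?thesis using kummer_kernel_laplace(3)[OF a, of 0 n] a by (simp add: E_def)
  qed
  also have "4 * sqrt a * (pi * (LBINT x:{0<..}. B x) + pi / 2 * (hyp2F1 (- real n) 1 (3/2) 2 / (2 * pi * a)) -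
      1/2 * ((LBINT t:{0<..}. kummer_kernel n t) / (4 * sqrt a))) =
      4 * pi * sqrt a * (LBINT x:{0<..}. B x) + sqrt a * hyp2F1 (- real n) 1 (3/2) 2 / a
           - (LBINT t:{0<..}. kummer_kernel n t) / 2"
    using a by (simp add: algebra_simps)
  also have "sqrt a * hyp2F1 (- real n) 1 (3/2) 2 / a = hyp2F1 (- real n) 1 (3/2) 2 / sqrt a"
    using a by (simp add: field_simps)
  finally show "(LBINT t:{0<..}. phi_theta a t * kummer_kernel n t) =
           4 * pi * sqrt a * (LBINT x:{0<..}. B x) + hyp2F1 (- real n) 1 (3/2) 2 / sqrt a
           - (LBINT t:{0<..}. kummer_kernel n t) / 2" .
qed

text \<open>The substitution \<open>t = 1 / u\<close> carries the unit interval to the half-line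
  beyond 1, where the two inversion formulas turn \<open>phi_theta\<close> into
  \<open>psi_theta\<close> and reproduce the kernel.\<close>

lemma theta_kummer_kernel_inversion:
  assumes a: "a > 0" and n: "even n"
  shows "set_integrable lborel {1<..} (\<lambda>t. (psi_theta a t + 1/2) * kummer_kernel n t)"
    and "(LBINT t:{1<..}. (psi_theta a t + 1/2) * kummer_kernel n t) =
         sqrt a * (LBINT t:{0<..<1}. (phi_theta a t + 1/2) * kummer_kernel n t)"
proof -
  define f where "f t = sqrt a * ((phi_theta a t + 1/2) * kummer_kernel n t)" for t
  define h where "h t = (psi_theta a t + 1/2) * kummer_kernel n t" for t
  have [measurable]: "f \<in> borel_measurable borel" "h \<in> borel_measurable borel"
    unfolding f_def h_def by measurable
  have "set_integrable lborel {0<..} (kummer_kernel n)"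
    using kummer_kernel_laplace(2)[OF a, where c = 0 and n = n] by simp
  then have "set_integrable lborel {0<..} (\<lambda>t. sqrt a * (phi_theta a t * kummer_kernel n t + 1/2 * kummer_kernel n t))"
    by (intro set_integrable_mult_right set_integral_add(1) phi_kummer_kernel_integral(1) a n)
  then have "set_integrable lborel {0<..} f"
    by (simp add: f_def[abs_def] distrib_right)
  then have fint: "set_integrable lborel {0<..<1} f"
    by (rule set_integrable_subset) auto
  \<comment> \<open>The change of variables is stated for absolute integrability over the completed
    measure; for Borel functions this agrees with integrability over \<open>lborel\<close>.\<close>
  have abs_iff: "g absolutely_integrable_on S \<longleftrightarrow> set_integrable lborel S g"
    if [measurable]: "g \<in> borel_measurable borel" "S \<in> sets borel" for g :: "real \<Rightarrow> real" and S
    unfolding set_integrable_def by (rule integrable_completion) measurable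
  have img: "(\<lambda>u. 1 / u) ` {1<..} = {0<..<1::real}"
  proof (intro equalityI subsetI)
    fix x :: real assume "x \<in> {0<..<1}"
    then show "x \<in> (\<lambda>u. 1 / u) ` {1<..}" by (intro image_eqI[of _ _ "1 / x"]) auto
  qed auto
  \<comment> \<open>The kernel contributes \<open>u * sqrt u\<close> and the theta series another
    \<open>sqrt u\<close>; their product \<open>u\<^sup>2\<close> cancels the Jacobian
    exactly.\<close>
  have fh: "\<bar>- 1 / u\<^sup>2\<bar> * f (1 / u) = h u" if "u \<in> {1<..}" for u
  proof -
    have u: "u > 0" using that by simp
    have "f (1 / u) = (sqrt a * (phi_theta a (1 / u) + 1/2)) * kummer_kernel n (1 / u)"
      by (simp add: f_def)
    also have "\<dots> = (sqrt u * sqrt u) * u * h u"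
      unfolding phi_theta_inverse[OF a u] kummer_kernel_inverse[OF n u] h_def by simp
    finally show ?thesis using u by (simp add: power2_eq_square)
  qed
  have der: "((\<lambda>u. 1 / u) has_real_derivative (- 1 / u\<^sup>2)) (at u within {1<..})" if "u \<in> {1<..}" for u :: real
    using that by (auto intro!: derivative_eq_intros simp: power2_eq_square)
  have cov: "(\<lambda>u. \<bar>- 1 / u\<^sup>2\<bar> * f (1 / u)) absolutely_integrable_on {1<..} \<and>
      integral {1<..} (\<lambda>u. \<bar>- 1 / u\<^sup>2\<bar> * f (1 / u)) = integral {0<..<1} f"
    using has_absolute_integral_change_of_variables_1'[OF _ der, of f "integral {0<..<1} f"] fint
    unfolding img by (auto simp: abs_iff inj_on_def)
  have "((\<lambda>u. \<bar>- 1 / u\<^sup>2\<bar> * f (1 / u)) absolutely_integrable_on {1<..}) = (h absolutely_integrable_on {1<..})"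
    by (rule set_integrable_cong[OF refl refl fh])
  moreover have "integral {1<..} (\<lambda>u. \<bar>- 1 / u\<^sup>2\<bar> * f (1 / u)) = integral {1<..} h"
    by (rule Henstock_Kurzweil_Integration.integral_cong[OF fh])
  ultimately have "h absolutely_integrable_on {1<..}" and eq: "integral {1<..} h = integral {0<..<1} f"
    using cov by (simp_all only:)
  then have hint: "set_integrable lborel {1<..} h" by (simp add: abs_iff)
  then show "set_integrable lborel {1<..} (\<lambda>t. (psi_theta a t + 1/2) * kummer_kernel n t)"
    by (simp add: h_def[abs_def])
  have "(LBINT t:{1<..}. h t) = (LBINT t:{0<..<1}. f t)"
    using eq set_borel_integral_eq_integral(2)[OF hint] set_borel_integral_eq_integral(2)[OF fint] by simp
  then show "(LBINT t:{1<..}. (psi_theta a t + 1/2) * kummer_kernel n t) =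
         sqrt a * (LBINT t:{0<..<1}. (phi_theta a t + 1/2) * kummer_kernel n t)"
    by (simp add: h_def f_def)
qed

section \<open>Splitting at 1 and assembling the identity\<close>

lemma set_integral_split_Ioi:
  fixes f :: "real \<Rightarrow> real"
  assumes "set_integrable lborel {0<..} f"
  shows "(LBINT t:{0<..}. f t) = (LBINT t:{0<..<1}. f t) + (LBINT t:{1<..}. f t)"
proof -
  have i: "set_integrable lborel {0<..<1} f" "set_integrable lborel {1<..} f"
    by (rule set_integrable_subset[OF assms]; auto)+
  have "(LBINT t:{0<..}. f t) = (LBINT t:{0<..<1} \<union> {1<..}. f t)"
  proof (unfold set_lebesgue_integral_def, rule integral_cong_AE)
    show "AE x in lborel. indicat_real {0<..} x *\<^sub>R f x = indicat_real ({0<..<1} \<union> {1<..}) x *\<^sub>R f x"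
      using AE_lborel_singleton[of 1] by eventually_elim (auto simp: indicator_def)
  qed (use assms set_integrable_Un[OF i] in \<open>auto simp: set_integrable_def dest: borel_measurable_integrable\<close>)
  also have "\<dots> = (LBINT t:{0<..<1}. f t) + (LBINT t:{1<..}. f t)"
    by (rule set_integral_Un[OF _ i]) auto
  finally show ?thesis .
qed

theorem theorem1:
  fixes a :: real and k :: nat
  assumes "a > 0" and "k \<ge> 1"
  shows "J k a = T k a + eps k a"
proof -
  define n where "n = 2 * k"
  have a: "a > 0" and n: "even n" using assms by (auto simp: n_def)
  define K where "K = kummer_kernel n"
  define H where "H = hyp2F1 (- real n) 1 (3/2) 2"
  let ?\<phi> = "phi_theta a" and ?\<psi> = "psi_theta a"
  have K0: "set_integrable lborel {0<..} K"
    using kummer_kernel_laplace(2)[OF a, where c = 0 and n = n] by (simp add: K_def)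
  have \<phi>0: "set_integrable lborel {0<..} (\<lambda>t. ?\<phi> t * K t)"
    unfolding K_def by (rule phi_kummer_kernel_integral(1)[OF a n])
  have K1: "set_integrable lborel {1<..} K" "set_integrable lborel {0<..<1} K"
    by (rule set_integrable_subset[OF K0]; auto)+
  have \<phi>1: "set_integrable lborel {1<..} (\<lambda>t. ?\<phi> t * K t)" "set_integrable lborel {0<..<1} (\<lambda>t. ?\<phi> t * K t)"
    by (rule set_integrable_subset[OF \<phi>0]; auto)+
  \<comment> \<open>Inversion yields integrability only for the completed sum
    \<open>?\<psi> t + 1/2\<close>; the half kernel is subtracted again.\<close>
  have "set_integrable lborel {1<..} (\<lambda>t. (?\<psi> t + 1/2) * K t - 1/2 * K t)"
    unfolding K_def
    by (intro set_integral_diff(1) theta_kummer_kernel_inversion(1)[OF a n] set_integrable_mult_right K1(1)[unfolded K_def])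
  then have \<psi>1: "set_integrable lborel {1<..} (\<lambda>t. ?\<psi> t * K t)" by (simp add: algebra_simps)
  have J_eq: "J k a = (LBINT x:{0<..}. x * kummer_gauss n a x / (exp (2 * pi * x) - 1))"
    unfolding J_def kummer_gauss_def n_def by (simp add: mult_ac)
  define I\<phi>0 I\<phi>1 I\<psi> IK0 IK1 where
    "I\<phi>0 = (LBINT t:{0<..<1}. ?\<phi> t * K t)" and "I\<phi>1 = (LBINT t:{1<..}. ?\<phi> t * K t)"
    and "I\<psi> = (LBINT t:{1<..}. ?\<psi> t * K t)"
    and "IK0 = (LBINT t:{0<..<1}. K t)" and "IK1 = (LBINT t:{1<..}. K t)"
  \<comment> \<open>\<open>main\<close> and \<open>inv\<close> are two linear relations among the
    five integrals and \<open>J k a\<close>. The integrals over the unit interval,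
    \<open>I\<phi>0\<close> and \<open>IK0\<close>, occur in neither \<open>T\<close> nor
    \<open>eps\<close> and have to be eliminated.\<close>
  have main: "I\<phi>0 + I\<phi>1 = 4 * pi * sqrt a * J k a + H / sqrt a - (IK0 + IK1) / 2"
    using phi_kummer_kernel_integral(2)[OF a n] set_integral_split_Ioi[OF K0] set_integral_split_Ioi[OF \<phi>0]
    by (simp add: J_eq K_def H_def I\<phi>0_def I\<phi>1_def IK0_def IK1_def)
  have "(LBINT t:{1<..}. ?\<psi> t * K t + 1/2 * K t) = sqrt a * (LBINT t:{0<..<1}. ?\<phi> t * K t + 1/2 * K t)"
    using theta_kummer_kernel_inversion(2)[OF a n] by (simp only: K_def distrib_right)
  then have inv: "I\<psi> + IK1 / 2 = sqrt a * (I\<phi>0 + IK0 / 2)"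
    by (simp add: set_integral_add \<psi>1 \<phi>1 K1 I\<psi>_def IK1_def I\<phi>0_def IK0_def)
  have "eps k a = 1 / (4 * pi * a) * (LBINT t:{1<..}. ?\<psi> t * K t + sqrt a * (?\<phi> t * K t))"
    unfolding eps_def K_def kummer_kernel_def n_def by (simp add: algebra_simps add_divide_distrib)
  also have "(LBINT t:{1<..}. ?\<psi> t * K t + sqrt a * (?\<phi> t * K t)) = I\<psi> + sqrt a * I\<phi>1"
    by (simp only: set_integral_add set_integrable_mult_right set_integral_mult_right \<psi>1 \<phi>1 I\<psi>_def I\<phi>1_def)
  finally have eps_eq: "4 * pi * a * eps k a = I\<psi> + sqrt a * I\<phi>1" using a by simp
  have T_eq: "4 * pi * a * T k a = (1 + sqrt a) / 2 * IK1 - H"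
  proof -
    have "IK1 = sqrt (pi / 2) * Gamma (real (2 * k) + 1) / Gamma (real (2 * k) + 3/2)"
      unfolding IK1_def K_def n_def by (rule kummer_kernel_integral)
    then have "4 * pi * a * T k a = 4 * pi * a * (1 / (4 * pi * a) * ((1 + sqrt a) / 2 * IK1 - H))"
      unfolding T_def H_def n_def by simp
    then show ?thesis using a by simp
  qed
  have sq: "sqrt a * sqrt a = a" using a by simp
  \<comment> \<open>Multiplying \<open>main\<close> by \<open>sqrt a\<close> produces the term
    \<open>sqrt a * I\<phi>0\<close> that \<open>inv\<close> replaces. The \<open>IK0\<close> terms
    then cancel, and the two halves of \<open>IK1\<close> combine to the factor
    \<open>(1 + sqrt a) / 2\<close> of \<open>T\<close>.\<close>
  have "sqrt a * (I\<phi>0 + I\<phi>1) = 4 * pi * (sqrt a * sqrt a) * J k a + sqrt a * (H / sqrt a) - sqrt a * (IK0 + IK1) / 2"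
    unfolding main by (simp add: algebra_simps)
  then have "sqrt a * (I\<phi>0 + I\<phi>1) = 4 * pi * a * J k a + H - sqrt a * (IK0 + IK1) / 2"
    unfolding sq using a by simp
  then have "4 * pi * a * J k a = 4 * pi * a * T k a + 4 * pi * a * eps k a"
    unfolding T_eq eps_eq using inv by (simp add: algebra_simps add_divide_distrib)
  then have "4 * pi * a * J k a = 4 * pi * a * (T k a + eps k a)" by (simp add: distrib_left)
  then show ?thesis using a by simp
qed

end
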